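(* Let $\{\Omega(n)\}_{n}$ be positive real numbers with $\Omega(n)\downarrow 0$ (that is, the sequence is decreasing with limit $0$ as $n\to\infty$). Then for every $\varepsilon\in(0,1)$ there exists a compact set $E\subset\mathbb{T}$ with $m(E)>1-\varepsilon$ such that: (i) There exists a non-negative, nontrivial (not $m$-a.e. zero) function $f\in L^2(\mathbb{T},dm)$ supported on $E$ whose Fourier coefficients satisfy $$\{\widehat{f}(n)\}_{n\in\mathbb{Z}}\in\bigcap_{r>1}\ell^r.$$ (ii) If $\mu\in M(E)$ satisfies the uniform unilateral estimate $$|\widehat{\mu}(n)|\le\Omega(n),\qquad n=1,2,3,\ldots,$$ then $\mu\equiv 0$.
   Context: $\mathbb{T}\cong[0,1)$ is the unit circle and $m$ is the Lebesgue measure on $\mathbb{T}$ normalized so that $m(\mathbb{T})=1$. $M(E)$ denotes the set of complex finite Borel measures on $\mathbb{T}$ supported in the compact set $E$. For $\mu\in M(E)$, $\widehat{\mu}(n)=\int_{\mathbb{T}}\zeta^{-n}\,d\mu(\zeta)$, $n\in\mathbb{Z}$, and for $f\in L^1(\mathbb{T},dm)$, $\widehat{f}(n)=\int_{\mathbb{T}}f(\zeta)\zeta^{-n}\,dm(\zeta)$. A function $f$ is supported on $E$ if $f=0$ $m$-a.e. on $\mathbb{T}\setminus E$. $\ell^r=\ell^r(\mathbb{Z})$. *)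

theory Defs
  imports "HOL-Analysis.Analysis"
begin

section \<open>The circle\<close>

abbreviation circle :: "complex set" where
  "circle \<equiv> sphere 0 1"

definition circle_borel :: "complex measure" where
  "circle_borel = restrict_space borel circle"

text \<open>Normalized Lebesgue measure, transported from \<open>[0,1)\<close> by \<open>t \<mapsto> exp (2 \<pi> i t)\<close>.\<close>

definition circle_lebesgue :: "complex measure" where
  "circle_lebesgue =
     distr (restrict_space lborel {0..<1::real}) circle_borel (\<lambda>t. cis (2 * pi * t))"

lemma space_circle_borel [simp]: "space circle_borel = circle"
  by (simp add: circle_borel_def space_restrict_space)

lemma sets_circle_borel_iff: "A \<in> sets circle_borel \<longleftrightarrow> A \<subseteq> circle \<and> A \<in> sets borel"
  by (auto simp: circle_borel_def sets_restrict_space_iff)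

lemma space_circle_lebesgue [simp]: "space circle_lebesgue = circle"
  by (simp add: circle_lebesgue_def)

lemma sets_circle_lebesgue [simp, measurable_cong]: "sets circle_lebesgue = sets circle_borel"
  by (simp add: circle_lebesgue_def)

lemma measurable_cis_circle [measurable]:
  "(\<lambda>t. cis (2 * pi * t)) \<in> restrict_space lborel {0..<1::real} \<rightarrow>\<^sub>M circle_borel"
proof -
  have "(\<lambda>t::real. cis (2 * pi * t)) \<in> borel_measurable borel"
    by (intro borel_measurable_continuous_onI continuous_intros)
  then show ?thesis
    unfolding circle_borel_def
    by (intro measurable_restrict_space2 measurable_restrict_space1) auto
qed

lemma emeasure_circle_lebesgue_space: "emeasure circle_lebesgue circle = 1"
proof -
  have "(\<lambda>t::real. cis (2 * pi * t)) -` circle \<inter> {0..<1} = {0..<1}"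
    by auto
  moreover have "circle \<in> sets circle_borel"
    by (simp add: sets_circle_borel_iff)
  ultimately show ?thesis
    by (simp add: circle_lebesgue_def emeasure_distr emeasure_restrict_space
        space_restrict_space)
qed


section \<open>Complex measures\<close>

text \<open>
  A complex measure is a countably additive complex-valued set function. The library's type of
  measures only covers values in \<open>[0,\<infinity>]\<close>, so complex measures are plain functions on sets, of
  which only the values on \<open>sets M\<close> matter. Finiteness is automatic.
\<close>

definition countably_additive_on ::
    "'a measure \<Rightarrow> ('a set \<Rightarrow> 'b::{comm_monoid_add,topological_space}) \<Rightarrow> bool" where
  "countably_additive_on M \<nu> \<longleftrightarrow>
     (\<forall>A::nat \<Rightarrow> 'a set. range A \<subseteq> sets M \<longrightarrow> disjoint_family A \<longrightarrow>
        (\<lambda>i. \<nu> (A i)) sums \<nu> (\<Union>i. A i))"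

definition complex_measure :: "'a measure \<Rightarrow> ('a set \<Rightarrow> complex) \<Rightarrow> bool" where
  "complex_measure M \<mu> \<longleftrightarrow> countably_additive_on M \<mu>"

text \<open>
  The positive variation of a finite signed measure. The empty set is among the competing sets, so
  negative values, which \<open>ennreal\<close> truncates to 0, do not affect the supremum. That this supremum
  is a finite measure, and that a signed measure is the difference of its variations, is
  established below.
\<close>

definition pos_variation :: "'a measure \<Rightarrow> ('a set \<Rightarrow> real) \<Rightarrow> 'a measure" where
  "pos_variation M \<nu> =
     measure_of (space M) (sets M) (\<lambda>A. SUP B\<in>{B \<in> sets M. B \<subseteq> A}. ennreal (\<nu> B))"

definition neg_variation :: "'a measure \<Rightarrow> ('a set \<Rightarrow> real) \<Rightarrow> 'a measure" where
  "neg_variation M \<nu> = pos_variation M (\<lambda>A. - \<nu> A)"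

definition signed_integral :: "'a measure \<Rightarrow> ('a set \<Rightarrow> real) \<Rightarrow> ('a \<Rightarrow> complex) \<Rightarrow> complex" where
  "signed_integral M \<nu> f =
     (\<integral>x. f x \<partial>pos_variation M \<nu>) - (\<integral>x. f x \<partial>neg_variation M \<nu>)"

definition complex_measure_integral ::
    "'a measure \<Rightarrow> ('a set \<Rightarrow> complex) \<Rightarrow> ('a \<Rightarrow> complex) \<Rightarrow> complex" where
  "complex_measure_integral M \<mu> f =
     signed_integral M (\<lambda>A. Re (\<mu> A)) f + \<i> * signed_integral M (\<lambda>A. Im (\<mu> A)) f"

text \<open>
  \<open>measures_on E\<close> is intended for compact \<open>E \<subseteq> circle\<close>, where the support of \<open>\<mu>\<close> is contained in
  \<open>E\<close> iff \<open>\<mu>\<close> vanishes on every Borel set disjoint from \<open>E\<close>. (Vanishing on the complement of \<open>E\<close>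
  alone would not suffice because of cancellation.)
\<close>

definition measures_on :: "complex set \<Rightarrow> (complex set \<Rightarrow> complex) set" where
  "measures_on E =
     {\<mu>. complex_measure circle_borel \<mu> \<and>
         (\<forall>A\<in>sets circle_borel. A \<inter> E = {} \<longrightarrow> \<mu> A = 0)}"


section \<open>Fourier coefficients and sequence spaces\<close>

definition fourier_coeff_measure :: "(complex set \<Rightarrow> complex) \<Rightarrow> int \<Rightarrow> complex" where
  "fourier_coeff_measure \<mu> n = complex_measure_integral circle_borel \<mu> (\<lambda>\<zeta>. \<zeta> powi (- n))"

definition fourier_coeff :: "(complex \<Rightarrow> complex) \<Rightarrow> int \<Rightarrow> complex" where
  "fourier_coeff f n = (\<integral>\<zeta>. f \<zeta> * \<zeta> powi (- n) \<partial>circle_lebesgue)"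

definition ell :: "real \<Rightarrow> (int \<Rightarrow> complex) set" where
  "ell r = {a. (\<lambda>n. cmod (a n) powr r) summable_on UNIV}"


section \<open>Jordan decomposition\<close>

context
  fixes M :: "'a measure" and \<nu> :: "'a set \<Rightarrow> real"
  assumes ca: "countably_additive_on M \<nu>"
begin

private definition P :: "'a set \<Rightarrow> ennreal" where
  "P A = (SUP B\<in>{B \<in> sets M. B \<subseteq> A}. ennreal (\<nu> B))"

private definition V :: "'a set \<Rightarrow> ennreal" where
  "V A = (SUP B\<in>{B \<in> sets M. B \<subseteq> A}. ennreal \<bar>\<nu> B\<bar>)"

lemma signed_sums:
  assumes "range A \<subseteq> sets M" "disjoint_family (A :: nat \<Rightarrow> 'a set)"
  shows "(\<lambda>i. \<nu> (A i)) sums \<nu> (\<Union>i. A i)"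
  using ca assms by (auto simp: countably_additive_on_def)

lemma signed_empty: "\<nu> {} = 0"
proof -
  have "(\<lambda>i::nat. \<nu> {}) sums \<nu> (\<Union>i::nat. {})"
    by (rule signed_sums) (auto simp: disjoint_family_on_def)
  then have "summable (\<lambda>i::nat. \<nu> {})"
    by (rule sums_summable)
  then show ?thesis
    by (simp add: summable_const_iff)
qed

lemma signed_Un:
  assumes "A \<in> sets M" "B \<in> sets M" "A \<inter> B = {}"
  shows "\<nu> (A \<union> B) = \<nu> A + \<nu> B"
proof -
  have "(\<lambda>i. \<nu> (binaryset A B i)) sums \<nu> (\<Union>i. binaryset A B i)"
  proof (rule signed_sums)
    show "range (binaryset A B) \<subseteq> sets M"
      using assms by (auto simp: range_binaryset_eq)
    show "disjoint_family (binaryset A B)"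
      using assms(3) by (auto simp: disjoint_family_on_def binaryset_def)
  qed
  moreover have "(\<lambda>i. \<nu> (binaryset A B i)) sums (\<nu> A + \<nu> B)"
    by (rule binaryset_sums) (rule signed_empty)
  ultimately show ?thesis
    by (simp add: UN_binaryset_eq sums_unique2)
qed

lemma signed_Diff:
  assumes "A \<in> sets M" "B \<in> sets M" "B \<subseteq> A"
  shows "\<nu> (A - B) = \<nu> A - \<nu> B"
proof -
  have "\<nu> (B \<union> (A - B)) = \<nu> B + \<nu> (A - B)"
    using assms by (intro signed_Un) auto
  moreover have "B \<union> (A - B) = A"
    using assms(3) by auto
  ultimately show ?thesis by simp
qed

private lemma P_upper: "B \<in> sets M \<Longrightarrow> B \<subseteq> A \<Longrightarrow> ennreal (\<nu> B) \<le> P A"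
  unfolding P_def by (rule SUP_upper) auto

private lemma P_superadd:
  assumes "A \<in> sets M" "B \<in> sets M" "A \<inter> B = {}"
  shows "P A + P B \<le> P (A \<union> B)"
proof -
  have *: "ennreal (\<nu> C) + ennreal (\<nu> D) \<le> P (A \<union> B)"
    if C: "C \<in> sets M" "C \<subseteq> A" and D: "D \<in> sets M" "D \<subseteq> B" for C D
  proof -
    consider "\<nu> C \<le> 0" | "\<nu> D \<le> 0" | "\<nu> C \<ge> 0" "\<nu> D \<ge> 0" by linarith
    then show ?thesis
    proof cases
      case 1
      then show ?thesis using P_upper[of D "A \<union> B"] D by (auto simp: ennreal_neg)
    next
      case 2
      then show ?thesis using P_upper[of C "A \<union> B"] C by (auto simp: ennreal_neg)
    next
      case 3
      have "\<nu> (C \<union> D) = \<nu> C + \<nu> D"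
        using C D assms(3) by (intro signed_Un) auto
      then have "ennreal (\<nu> C) + ennreal (\<nu> D) = ennreal (\<nu> (C \<union> D))"
        using 3 by simp
      also have "\<dots> \<le> P (A \<union> B)"
        using C D by (intro P_upper) auto
      finally show ?thesis .
    qed
  qed
  have "P A + P B = (SUP C\<in>{C \<in> sets M. C \<subseteq> A}. ennreal (\<nu> C) + P B)"
    unfolding P_def[of A] by (subst ennreal_SUP_add_left[symmetric]) auto
  also have "\<dots> \<le> P (A \<union> B)"
  proof (rule SUP_least)
    fix C assume C: "C \<in> {C \<in> sets M. C \<subseteq> A}"
    have "ennreal (\<nu> C) + P B = (SUP D\<in>{D \<in> sets M. D \<subseteq> B}. ennreal (\<nu> C) + ennreal (\<nu> D))"
      unfolding P_def[of B] by (subst ennreal_SUP_add_right[symmetric]) auto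
    also have "\<dots> \<le> P (A \<union> B)"
      using C * by (intro SUP_least) auto
    finally show "ennreal (\<nu> C) + P B \<le> P (A \<union> B)" .
  qed
  finally show ?thesis .
qed

private lemma P_mono: "A \<subseteq> B \<Longrightarrow> P A \<le> P B"
  unfolding P_def by (intro SUP_subset_mono) auto

private lemma P_countably_additive: "countably_additive (sets M) P"
proof (rule countably_additiveI)
  fix A :: "nat \<Rightarrow> 'a set"
  assume A: "range A \<subseteq> sets M" "disjoint_family A" "(\<Union>i. A i) \<in> sets M"
  show "(\<Sum>i. P (A i)) = P (\<Union>i. A i)"
  proof (rule antisym)
    have fin: "(\<Sum>i<n. P (A i)) \<le> P (\<Union>i<n. A i)" for n
    proof (induction n)
      case 0
      then show ?case by simp
    next
      case (Suc n)
      have "A i \<inter> A n = {}" if "i < n" for i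
        using A(2) that by (intro disjoint_family_onD) auto
      then have "(\<Union>i<n. A i) \<inter> A n = {}"
        by blast
      then have "P (\<Union>i<n. A i) + P (A n) \<le> P ((\<Union>i<n. A i) \<union> A n)"
        using A(1) by (intro P_superadd) auto
      moreover have "(\<Union>i<n. A i) \<union> A n = (\<Union>i<Suc n. A i)"
        by (auto simp: lessThan_Suc)
      ultimately have "P (\<Union>i<n. A i) + P (A n) \<le> P (\<Union>i<Suc n. A i)"
        by simp
      moreover have "(\<Sum>i<Suc n. P (A i)) \<le> P (\<Union>i<n. A i) + P (A n)"
        using add_right_mono[OF Suc.IH] by simp
      ultimately show ?case
        by (rule order_trans[rotated])
    qed
    show "(\<Sum>i. P (A i)) \<le> P (\<Union>i. A i)"
      by (rule suminf_le_const) (auto intro!: order_trans[OF fin] P_mono)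
    show "P (\<Union>i. A i) \<le> (\<Sum>i. P (A i))"
      unfolding P_def[of "\<Union>i. A i"]
    proof (rule SUP_least)
      fix B assume B: "B \<in> {B \<in> sets M. B \<subseteq> (\<Union>i. A i)}"
      have "(\<lambda>i. \<nu> (B \<inter> A i)) sums \<nu> (\<Union>i. B \<inter> A i)"
      proof (rule signed_sums)
        show "range (\<lambda>i. B \<inter> A i) \<subseteq> sets M" using A B by auto
        show "disjoint_family (\<lambda>i. B \<inter> A i)" using A(2) by (auto simp: disjoint_family_on_def)
      qed
      moreover have "(\<Union>i. B \<inter> A i) = B" using B by auto
      ultimately have lim: "(\<lambda>n. \<Sum>i<n. \<nu> (B \<inter> A i)) \<longlonglongrightarrow> \<nu> B"
        by (simp add: sums_def)
      have "ennreal (\<Sum>i<n. \<nu> (B \<inter> A i)) \<le> (\<Sum>i. P (A i))" for n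
      proof -
        have "ennreal (\<Sum>i<n. \<nu> (B \<inter> A i)) \<le> ennreal (\<Sum>i<n. max 0 (\<nu> (B \<inter> A i)))"
          by (intro ennreal_leI sum_mono) auto
        also have "\<dots> = (\<Sum>i<n. ennreal (max 0 (\<nu> (B \<inter> A i))))"
          by (rule sum_ennreal[symmetric]) auto
        also have "\<dots> \<le> (\<Sum>i<n. P (A i))"
        proof (rule sum_mono)
          fix i
          have "ennreal (max 0 (\<nu> (B \<inter> A i))) = ennreal (\<nu> (B \<inter> A i))"
            by (auto simp: max_def ennreal_neg)
          also have "\<dots> \<le> P (A i)"
            using A B by (intro P_upper) auto
          finally show "ennreal (max 0 (\<nu> (B \<inter> A i))) \<le> P (A i)" .
        qed
        also have "\<dots> \<le> (\<Sum>i. P (A i))"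
          by (rule sum_le_suminf) auto
        finally show ?thesis .
      qed
      moreover have "(\<lambda>n. ennreal (\<Sum>i<n. \<nu> (B \<inter> A i))) \<longlonglongrightarrow> ennreal (\<nu> B)"
        using lim by (rule tendsto_ennrealI)
      ultimately show "ennreal (\<nu> B) \<le> (\<Sum>i. P (A i))"
        by (intro LIMSEQ_le_const2) auto
    qed
  qed
qed

lemma sets_pos_variation [simp]: "sets (pos_variation M \<nu>) = sets M"
  and space_pos_variation [simp]: "space (pos_variation M \<nu>) = space M"
  by (simp_all add: pos_variation_def)

lemma emeasure_pos_variation:
  assumes "A \<in> sets M"
  shows "emeasure (pos_variation M \<nu>) A = (SUP B\<in>{B \<in> sets M. B \<subseteq> A}. ennreal (\<nu> B))"
  unfolding P_def[symmetric]
proof (rule emeasure_measure_of)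
  show "pos_variation M \<nu> = measure_of (space M) (sets M) P"
    by (simp add: pos_variation_def P_def[abs_def])
  have "{B \<in> sets M. B \<subseteq> {}} = {{}}" by auto
  then show "positive (sets (pos_variation M \<nu>)) P"
    by (simp add: positive_def P_def signed_empty)
  show "countably_additive (sets (pos_variation M \<nu>)) P"
    using P_countably_additive by simp
  show "A \<in> sets (pos_variation M \<nu>)"
    using assms by simp
  show "sets M \<subseteq> Pow (space M)"
    by (rule sets.space_closed)
qed

private lemma V_subadd:
  assumes "A \<in> sets M" "C \<in> sets M" "C \<subseteq> A"
  shows "V A \<le> V C + V (A - C)"
  unfolding V_def[of A]
proof (rule SUP_least)
  fix D assume D: "D \<in> {B \<in> sets M. B \<subseteq> A}"
  have "\<nu> ((D \<inter> C) \<union> (D - C)) = \<nu> (D \<inter> C) + \<nu> (D - C)"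
    using D assms by (intro signed_Un) auto
  moreover have "(D \<inter> C) \<union> (D - C) = D" by auto
  ultimately have "ennreal \<bar>\<nu> D\<bar> \<le> ennreal (\<bar>\<nu> (D \<inter> C)\<bar> + \<bar>\<nu> (D - C)\<bar>)"
    by (intro ennreal_leI) simp
  also have "\<dots> = ennreal \<bar>\<nu> (D \<inter> C)\<bar> + ennreal \<bar>\<nu> (D - C)\<bar>"
    by simp
  also have "\<dots> \<le> V C + V (A - C)"
    unfolding V_def using D assms by (intro add_mono SUP_upper) auto
  finally show "ennreal \<bar>\<nu> D\<bar> \<le> V C + V (A - C)" .
qed

private lemma V_split:
  assumes "A \<in> sets M" "V A = \<infinity>"
  shows "\<exists>B\<in>sets M. B \<subseteq> A \<and> \<bar>\<nu> B\<bar> > 1 \<and> V (A - B) = \<infinity>"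
proof -
  have "ennreal (1 + \<bar>\<nu> A\<bar>) < V A"
    using assms(2) by (metis ennreal_less_top infinity_ennreal_def)
  then obtain C where C: "C \<in> sets M" "C \<subseteq> A" "ennreal (1 + \<bar>\<nu> A\<bar>) < ennreal \<bar>\<nu> C\<bar>"
    unfolding V_def less_SUP_iff by auto
  then have gt: "1 + \<bar>\<nu> A\<bar> < \<bar>\<nu> C\<bar>"
    by (subst (asm) ennreal_less_iff) auto
  have "\<nu> (A - C) = \<nu> A - \<nu> C"
    using C assms by (intro signed_Diff) auto
  then have gt': "\<bar>\<nu> (A - C)\<bar> > 1"
    using gt by linarith
  have "V C + V (A - C) = \<infinity>"
    using V_subadd[OF assms(1) C(1,2)] assms(2) by (simp add: top_unique)
  then consider "V (A - C) = \<infinity>" | "V C = \<infinity>" by auto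
  then show ?thesis
  proof cases
    case 1
    then show ?thesis using C gt by (intro bexI[of _ C]) auto
  next
    case 2
    moreover have "A - (A - C) = C" using C by auto
    ultimately show ?thesis using C gt' assms by (intro bexI[of _ "A - C"]) auto
  qed
qed

private lemma V_finite: "V (space M) \<noteq> \<infinity>"
proof
  assume inf: "V (space M) = \<infinity>"
  obtain b where b: "\<And>A. A \<in> sets M \<Longrightarrow> V A = \<infinity> \<Longrightarrow>
      b A \<in> sets M \<and> b A \<subseteq> A \<and> \<bar>\<nu> (b A)\<bar> > 1 \<and> V (A - b A) = \<infinity>"
    using V_split by metis
  define S where "S = rec_nat (space M) (\<lambda>_ A. A - b A)"
  have S_simps: "S 0 = space M" "S (Suc n) = S n - b (S n)" for n
    by (simp_all add: S_def)
  have S: "S n \<in> sets M \<and> V (S n) = \<infinity>" for n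
    by (induction n) (use inf b in \<open>auto simp: S_simps\<close>)
  have dec: "S n \<subseteq> S m" if "m \<le> n" for m n
    using that by (induction rule: dec_induct) (auto simp: S_simps)
  have disj: "b (S m) \<inter> b (S n) = {}" if "m < n" for m n
  proof -
    have "b (S n) \<subseteq> S n" using b S by blast
    also have "\<dots> \<subseteq> S (Suc m)" using that by (intro dec) auto
    finally show ?thesis by (auto simp: S_simps)
  qed
  have "(\<lambda>n. \<nu> (b (S n))) sums \<nu> (\<Union>n. b (S n))"
  proof (rule signed_sums)
    show "range (\<lambda>n. b (S n)) \<subseteq> sets M" using b S by blast
    show "disjoint_family (\<lambda>n. b (S n))"
      unfolding disjoint_family_on_def
    proof (intro ballI impI)
      fix m n :: nat assume "m \<noteq> n"
      then show "b (S m) \<inter> b (S n) = {}"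
        using disj[of m n] disj[of n m] by (cases m n rule: linorder_cases) auto
    qed
  qed
  then have "(\<lambda>n. \<nu> (b (S n))) \<longlonglongrightarrow> 0"
    by (intro summable_LIMSEQ_zero sums_summable)
  then have "eventually (\<lambda>n. dist (\<nu> (b (S n))) 0 < 1) sequentially"
    by (rule tendstoD) simp
  then obtain n where "\<bar>\<nu> (b (S n))\<bar> < 1"
    by (auto simp: eventually_sequentially)
  moreover have "\<bar>\<nu> (b (S n))\<bar> > 1" using b S by blast
  ultimately show False by simp
qed

lemma finite_measure_pos_variation: "finite_measure (pos_variation M \<nu>)"
proof (rule finite_measureI)
  have "P (space M) \<le> V (space M)"
    unfolding P_def V_def by (intro SUP_mono') (auto intro!: ennreal_leI)
  then have "P (space M) \<noteq> \<infinity>"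
    using V_finite by (auto simp: top_unique)
  then show "emeasure (pos_variation M \<nu>) (space (pos_variation M \<nu>)) \<noteq> \<infinity>"
    by (simp add: emeasure_pos_variation P_def)
qed

end

lemma countably_additive_on_uminus:
  fixes \<nu> :: "'a set \<Rightarrow> real"
  shows "countably_additive_on M \<nu> \<Longrightarrow> countably_additive_on M (\<lambda>A. - \<nu> A)"
  by (auto simp: countably_additive_on_def intro!: sums_minus)

lemma signed_le_pos_variation:
  assumes "countably_additive_on M \<nu>" "A \<in> sets M" "B \<in> sets M" "B \<subseteq> A"
  shows "\<nu> B \<le> measure (pos_variation M \<nu>) A"
proof -
  interpret finite_measure "pos_variation M \<nu>"
    using assms(1) by (rule finite_measure_pos_variation)
  have "ennreal (\<nu> B) \<le> emeasure (pos_variation M \<nu>) A"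
    using assms by (auto simp: emeasure_pos_variation intro!: SUP_upper)
  then show ?thesis
    by (simp add: emeasure_eq_measure)
qed

lemma pos_variation_le:
  assumes "countably_additive_on M \<nu>" "A \<in> sets M"
    and le: "\<And>B. B \<in> sets M \<Longrightarrow> B \<subseteq> A \<Longrightarrow> \<nu> B \<le> c"
  shows "measure (pos_variation M \<nu>) A \<le> c"
proof -
  interpret finite_measure "pos_variation M \<nu>"
    using assms(1) by (rule finite_measure_pos_variation)
  have "0 \<le> c"
    using le[of "{}"] signed_empty[OF assms(1)] by simp
  moreover have "emeasure (pos_variation M \<nu>) A \<le> ennreal c"
    using assms by (auto simp: emeasure_pos_variation intro!: SUP_least ennreal_leI)
  ultimately show ?thesis
    by (simp add: emeasure_eq_measure)
qed

theorem jordan_decomposition: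
  assumes ca: "countably_additive_on M \<nu>" and A: "A \<in> sets M"
  shows "\<nu> A = measure (pos_variation M \<nu>) A - measure (neg_variation M \<nu>) A"
proof -
  note ca' = countably_additive_on_uminus[OF ca]
  have "measure (pos_variation M \<nu>) A \<le> \<nu> A + measure (neg_variation M \<nu>) A"
  proof (rule pos_variation_le[OF ca A])
    fix B assume B: "B \<in> sets M" "B \<subseteq> A"
    show "\<nu> B \<le> \<nu> A + measure (neg_variation M \<nu>) A"
      using signed_le_pos_variation[OF ca' A, of "A - B"] signed_Diff[OF ca A B] A B
      by (auto simp: neg_variation_def)
  qed
  moreover have "measure (neg_variation M \<nu>) A \<le> measure (pos_variation M \<nu>) A - \<nu> A"
    unfolding neg_variation_def
  proof (rule pos_variation_le[OF ca' A])
    fix B assume B: "B \<in> sets M" "B \<subseteq> A"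
    show "- \<nu> B \<le> measure (pos_variation M \<nu>) A - \<nu> A"
      using signed_le_pos_variation[OF ca A, of "A - B"] signed_Diff[OF ca A B] A B
      by auto
  qed
  ultimately show ?thesis by linarith
qed

lemma complex_measure_Re: "complex_measure M \<mu> \<Longrightarrow> countably_additive_on M (\<lambda>A. Re (\<mu> A))"
  unfolding complex_measure_def countably_additive_on_def
  by (intro allI impI sums_Re) simp

lemma complex_measure_Im: "complex_measure M \<mu> \<Longrightarrow> countably_additive_on M (\<lambda>A. Im (\<mu> A))"
  unfolding complex_measure_def countably_additive_on_def
  by (intro allI impI sums_Im) simp

end

theory Submission
  imports Defs "HOL-Real_Asymp.Real_Asymp"
begin

text \<open>
  The set \<open>E\<close> consists of the points of the circle with \<open>Re (\<zeta> ^ N j) \<le> \<kappa> j\<close> for all \<open>j\<close>, where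
  \<open>\<kappa> j = cos (2 * pi * h j)\<close>. So the \<open>j\<close>-th step removes \<open>N j\<close> equally spaced arcs, of total measure
  \<open>2 * h j\<close>. Two competing properties are needed of this construction, and the widths \<open>h j\<close> serve the
  first one, the dilation factors \<open>N j\<close> the second one.

  A non-negative function on \<open>E\<close> with good Fourier coefficients is the product of the functions
  \<open>1 - b j (\<zeta> ^ N j)\<close>, where \<open>b j\<close> is a trapezoid that equals \<open>1\<close> on the removed arc
  (\<open>bump_product\<close>). The coefficients of \<open>b j\<close> have a sum bounded independently of \<open>h j\<close> and a supremum at
  most \<open>3 * h j\<close>, so that their \<open>r\<close>-norm is small for every \<open>r > 1\<close> when \<open>h j\<close> is small. The \<open>j\<close>-th
  partial product has a Fourier series with absolute sum at most \<open>4 ^ j\<close>. If \<open>h j\<close> decreases like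
  \<open>2 powr (- j\<^sup>2)\<close>, then the increments of the partial products have summable \<open>r\<close>-norms for all \<open>r > 1\<close>
  at once (\<open>powr_summable_of_interpolation\<close>). The integral of the limit exceeds \<open>1 - \<epsilon>\<close>, and it is at
  most the measure of \<open>E\<close>.

  That \<open>E\<close> carries no nonzero measure with such small coefficients at positive frequencies rests on polynomials \<open>q j\<close>
  with constant term \<open>1\<close> that are small on the part \<open>Re z \<le> \<kappa> j\<close> of the circle
  (\<open>poly_small_off_arc\<close>). On \<open>E\<close> the function \<open>poly (q j) (cnj (\<zeta> ^ N j))\<close> is small. Its integral against
  \<open>\<zeta> powi (-k)\<close> and the measure is the coefficient at \<open>k\<close> plus a combination, with the coefficients
  of \<open>q j\<close>, of those at \<open>k + n * N j\<close> with \<open>n \<ge> 1\<close>. If \<open>N j\<close> is large, this combination is small because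
  \<open>\<Omega>\<close> tends to \<open>0\<close>. Hence all coefficients vanish (\<open>measures_on_eq_0_of_unilateral_bound\<close>), and so
  does the measure, as trigonometric polynomials are dense (\<open>complex_measure_eq_0\<close>).
\<close>

section \<open>Continuous functions and trigonometric polynomials on the circle\<close>

lemma compact_circle: "compact circle" by simp

lemma circle_nonzero: "\<zeta> \<in> circle \<Longrightarrow> \<zeta> \<noteq> 0" by auto

lemma norm_powi_circle: "\<zeta> \<in> circle \<Longrightarrow> cmod (\<zeta> powi k) = 1"
  by (simp add: norm_power_int)

lemma measurable_of_continuous_on_circle:
  "continuous_on circle F \<Longrightarrow> F \<in> borel_measurable circle_borel"
  unfolding circle_borel_def by (rule borel_measurable_continuous_on_restrict)

lemma bounded_on_circle:
  fixes F :: "complex \<Rightarrow> 'b::real_normed_vector"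
  assumes F: "continuous_on circle F"
  shows "\<exists>B\<ge>0. \<forall>\<zeta>\<in>circle. norm (F \<zeta>) \<le> B"
proof -
  have "\<exists>B>0. \<forall>y\<in>F ` circle. norm y \<le> B"
    using compact_imp_bounded[OF compact_continuous_image[OF F compact_circle]]
    unfolding bounded_pos .
  then show ?thesis by (auto intro: less_imp_le)
qed

lemma integrable_of_continuous_on_circle:
  fixes F :: "complex \<Rightarrow> 'b::{banach, second_countable_topology}"
  assumes M: "finite_measure M" "sets M = sets circle_borel" and F: "continuous_on circle F"
  shows "integrable M F"
proof -
  interpret finite_measure M by fact
  have sp: "space M = circle" using sets_eq_imp_space_eq[OF M(2)] by simp
  obtain B where B: "\<And>\<zeta>. \<zeta> \<in> circle \<Longrightarrow> norm (F \<zeta>) \<le> B"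
    using bounded_on_circle[OF F] by blast
  show ?thesis
  proof (rule integrable_const_bound)
    show "AE x in M. norm (F x) \<le> B" using B sp by (intro AE_I2) auto
    show "F \<in> borel_measurable M"
      using measurable_of_continuous_on_circle[OF F] measurable_cong_sets[OF M(2) refl] by blast
  qed
qed

lemma norm_integral_le_on_circle:
  fixes F :: "complex \<Rightarrow> 'b::{banach, second_countable_topology}"
  assumes M: "finite_measure M" "sets M = sets circle_borel" and "0 \<le> B"
    and B: "AE \<zeta> in M. norm (F \<zeta>) \<le> B"
  shows "norm (\<integral>\<zeta>. F \<zeta> \<partial>M) \<le> B * measure M circle"
proof -
  interpret finite_measure M by fact
  have sp: "space M = circle" using sets_eq_imp_space_eq[OF M(2)] by simp
  have "norm (\<integral>\<zeta>. F \<zeta> \<partial>M) \<le> (\<integral>\<zeta>. B \<partial>M)"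
  proof (cases "integrable M F")
    case True
    then show ?thesis
      by (intro order_trans[OF integral_norm_bound] integral_mono_AE B) auto
  next
    case False
    then show ?thesis using \<open>0 \<le> B\<close> by (simp add: not_integrable_integral_eq)
  qed
  then show ?thesis by (simp add: sp mult.commute)
qed

text \<open>
  The class of Laurent polynomials, taken up to equality on the circle: off the circle,
  at \<open>0\<close>, the product of two powers \<open>\<zeta> powi k\<close> is not a power.
\<close>
inductive trig_poly :: "(complex \<Rightarrow> complex) \<Rightarrow> bool" where
  monomial: "(\<And>\<zeta>. \<zeta> \<in> circle \<Longrightarrow> F \<zeta> = c * \<zeta> powi k) \<Longrightarrow> trig_poly F"
| add: "trig_poly F \<Longrightarrow> trig_poly G \<Longrightarrow> (\<And>\<zeta>. \<zeta> \<in> circle \<Longrightarrow> H \<zeta> = F \<zeta> + G \<zeta>) \<Longrightarrow> trig_poly H"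

lemma trig_poly_mult:
  assumes "trig_poly F" "trig_poly G"
  shows "trig_poly (\<lambda>\<zeta>. F \<zeta> * G \<zeta>)"
  using assms
proof (induction F rule: trig_poly.induct)
  case (monomial F c k)
  note F = monomial(1)
  from \<open>trig_poly G\<close> show ?case
  proof (induction G rule: trig_poly.induct)
    case (monomial G d l)
    show ?case
      by (rule trig_poly.monomial[of _ "c * d" "k + l"])
        (use F monomial in \<open>auto simp: power_int_add circle_nonzero\<close>)
  next
    case (add G G' H)
    show ?case by (rule trig_poly.add[OF add.IH]) (use add.hyps in \<open>simp add: distrib_left\<close>)
  qed
next
  case (add F F' H)
  show ?case
    by (rule trig_poly.add[OF add.IH(1)[OF add.prems] add.IH(2)[OF add.prems]])
      (use add.hyps in \<open>simp add: distrib_right\<close>)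
qed

lemma trig_poly_continuous: "trig_poly F \<Longrightarrow> continuous_on circle F"
proof (induction rule: trig_poly.induct)
  case (monomial F c k)
  have "continuous_on circle (\<lambda>\<zeta>. c * \<zeta> powi k)"
    by (intro continuous_intros) (auto simp: circle_nonzero)
  then show ?case using monomial by (subst continuous_on_cong[OF refl]) auto
next
  case (add F G H)
  then have "continuous_on circle (\<lambda>\<zeta>. F \<zeta> + G \<zeta>)" by (intro continuous_intros)
  then show ?case using add.hyps by (subst continuous_on_cong[OF refl]) auto
qed

text \<open>
  On the circle \<open>\<zeta> powi (-1) = cnj \<zeta>\<close>, so the real coordinates are combinations of
  \<open>\<zeta>\<close> and \<open>\<zeta> powi (-1)\<close>. This brings Weierstrass approximation in the plane down to
  trigonometric polynomials.
\<close>
lemma trig_poly_real_polynomial: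
  fixes p :: "complex \<Rightarrow> real"
  assumes "real_polynomial_function p"
  shows "trig_poly (\<lambda>\<zeta>. complex_of_real (p \<zeta>))"
  using assms
proof (induction p rule: real_polynomial_function.induct)
  case (linear f)
  interpret bounded_linear f by fact
  define a b where "a = complex_of_real (f 1)" and "b = complex_of_real (f \<i>)"
  have *: "complex_of_real (f \<zeta>) = (a - \<i> * b) / 2 * \<zeta> powi 1 + (a + \<i> * b) / 2 * \<zeta> powi (-1)"
    if "\<zeta> \<in> circle" for \<zeta>
  proof -
    have "\<zeta> = Re \<zeta> *\<^sub>R 1 + Im \<zeta> *\<^sub>R \<i>" by (simp add: complex_eq_iff)
    then have "f \<zeta> = f (Re \<zeta> *\<^sub>R 1 + Im \<zeta> *\<^sub>R \<i>)" by simp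
    also have "\<dots> = Re \<zeta> * f 1 + Im \<zeta> * f \<i>" by (simp only: add scaleR) simp
    finally have f: "f \<zeta> = Re \<zeta> * f 1 + Im \<zeta> * f \<i>" .
    have "inverse \<zeta> = cnj \<zeta>"
      using that by (intro inverse_unique) (simp add: complex_norm_square[symmetric])
    then have inv: "\<zeta> powi (-1) = cnj \<zeta>" by (simp add: power_int_minus)
    show ?thesis unfolding inv by (simp add: f a_def b_def complex_eq_iff field_simps)
  qed
  show ?case
    by (rule trig_poly.add[OF trig_poly.monomial[OF refl] trig_poly.monomial[OF refl] *])
next
  case (const c)
  show ?case by (rule trig_poly.monomial[of _ _ 0]) simp
next
  case (add f g)
  then show ?case by (auto intro: trig_poly.add[of "\<lambda>\<zeta>. complex_of_real (f \<zeta>)" "\<lambda>\<zeta>. complex_of_real (g \<zeta>)"])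
next
  case (mult f g)
  then show ?case by (auto intro: trig_poly_mult)
qed

lemma trig_poly_dense:
  fixes f :: "complex \<Rightarrow> real"
  assumes "continuous_on circle f" "0 < \<delta>"
  obtains p where "trig_poly (\<lambda>\<zeta>. complex_of_real (p \<zeta>))" "\<And>\<zeta>. \<zeta> \<in> circle \<Longrightarrow> \<bar>f \<zeta> - p \<zeta>\<bar> < \<delta>"
  using Stone_Weierstrass_real_polynomial_function[OF compact_circle assms]
    trig_poly_real_polynomial by metis

lemma trig_poly_dense_complex:
  assumes "continuous_on circle F" "0 < \<delta>"
  obtains P where "trig_poly P" "\<And>\<zeta>. \<zeta> \<in> circle \<Longrightarrow> cmod (F \<zeta> - P \<zeta>) < \<delta>"
proof -
  have re: "continuous_on circle (\<lambda>\<zeta>. Re (F \<zeta>))" and im: "continuous_on circle (\<lambda>\<zeta>. Im (F \<zeta>))"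
    using assms(1) by (auto intro: continuous_intros)
  have d: "\<delta>/2 > 0" using assms(2) by simp
  obtain p where p: "trig_poly (\<lambda>\<zeta>. complex_of_real (p \<zeta>))"
      "\<And>\<zeta>. \<zeta> \<in> circle \<Longrightarrow> \<bar>Re (F \<zeta>) - p \<zeta>\<bar> < \<delta>/2"
    using trig_poly_dense[OF re d] by blast
  obtain q where q: "trig_poly (\<lambda>\<zeta>. complex_of_real (q \<zeta>))"
      "\<And>\<zeta>. \<zeta> \<in> circle \<Longrightarrow> \<bar>Im (F \<zeta>) - q \<zeta>\<bar> < \<delta>/2"
    using trig_poly_dense[OF im d] by blast
  have "trig_poly (\<lambda>\<zeta>. \<i>)" by (rule trig_poly.monomial[of _ \<i> 0]) simp
  then have iq: "trig_poly (\<lambda>\<zeta>. \<i> * complex_of_real (q \<zeta>))" by (rule trig_poly_mult[OF _ q(1)])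
  show thesis
  proof (rule that)
    show "trig_poly (\<lambda>\<zeta>. complex_of_real (p \<zeta>) + \<i> * complex_of_real (q \<zeta>))"
      by (rule trig_poly.add[OF p(1) iq refl])
    fix \<zeta> :: complex assume z: "\<zeta> \<in> circle"
    have "cmod (F \<zeta> - (complex_of_real (p \<zeta>) + \<i> * complex_of_real (q \<zeta>)))
        \<le> \<bar>Re (F \<zeta>) - p \<zeta>\<bar> + \<bar>Im (F \<zeta>) - q \<zeta>\<bar>"
      by (rule order_trans[OF cmod_le]) simp
    then show "cmod (F \<zeta> - (complex_of_real (p \<zeta>) + \<i> * complex_of_real (q \<zeta>))) < \<delta>"
      using p(2)[OF z] q(2)[OF z] by linarith
  qed
qed

text \<open>
  The indicator of a closed set \<open>K\<close> is the bounded pointwise limit of the continuous functions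
  \<open>max 0 (1 - n * infdist \<zeta> K)\<close>, and closed sets generate the Borel sets.
\<close>
lemma finite_measure_eqI_continuous:
  assumes M: "finite_measure M" "sets M = sets circle_borel"
    and N: "finite_measure N" "sets N = sets circle_borel"
    and eq: "\<And>f :: complex \<Rightarrow> real. continuous_on circle f \<Longrightarrow> (\<integral>\<zeta>. f \<zeta> \<partial>M) = (\<integral>\<zeta>. f \<zeta> \<partial>N)"
  shows "M = N"
proof -
  interpret M: finite_measure M by fact
  interpret N: finite_measure N by fact
  have sp: "space M = circle" "space N = circle"
    using sets_eq_imp_space_eq[OF M(2)] sets_eq_imp_space_eq[OF N(2)] by auto
  have lim: "(\<lambda>n. \<integral>\<zeta>. max 0 (1 - real n * infdist \<zeta> K) \<partial>L) \<longlonglongrightarrow> measure L K"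
    if K: "closed K" "K \<subseteq> circle" "K \<noteq> {}" and L: "finite_measure L" "sets L = sets circle_borel"
    for K L
  proof -
    interpret L: finite_measure L by fact
    have spL: "space L = circle" using sets_eq_imp_space_eq[OF L(2)] by simp
    have "(\<lambda>n. \<integral>\<zeta>. max 0 (1 - real n * infdist \<zeta> K) \<partial>L) \<longlonglongrightarrow> (\<integral>\<zeta>. indicator K \<zeta> \<partial>L)"
    proof (rule integral_dominated_convergence[where w = "\<lambda>_. 1"])
      have KL: "K \<in> sets L" using K L by (simp add: sets_circle_borel_iff)
      then show "indicator K \<in> borel_measurable L" by simp
      show "(\<lambda>\<zeta>. max 0 (1 - real n * infdist \<zeta> K)) \<in> borel_measurable L" for n
      proof -
        have "continuous_on circle (\<lambda>\<zeta>. max 0 (1 - real n * infdist \<zeta> K))"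
          by (intro continuous_intros)
        from measurable_of_continuous_on_circle[OF this] show ?thesis
          using measurable_cong_sets[OF L(2) refl] by blast
      qed
      show "AE \<zeta> in L. norm (max 0 (1 - real n * infdist \<zeta> K)) \<le> 1" for n
        by (intro AE_I2) (simp add: infdist_nonneg)
      show "AE \<zeta> in L. (\<lambda>n. max 0 (1 - real n * infdist \<zeta> K)) \<longlonglongrightarrow> indicator K \<zeta>"
      proof (rule AE_I2)
        fix \<zeta>
        show "(\<lambda>n. max 0 (1 - real n * infdist \<zeta> K)) \<longlonglongrightarrow> indicator K \<zeta>"
        proof (cases "\<zeta> \<in> K")
          case True then show ?thesis by simp
        next
          case False
          then have pos: "infdist \<zeta> K > 0"
            using K in_closed_iff_infdist_zero[of K \<zeta>] infdist_nonneg[of \<zeta> K] by fastforce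
          have "\<forall>\<^sub>F n in sequentially. real n \<ge> 1 / infdist \<zeta> K"
            using filterlim_real_sequentially unfolding filterlim_at_top by blast
          then have "\<forall>\<^sub>F n in sequentially. max 0 (1 - real n * infdist \<zeta> K) = indicator K \<zeta>"
            by eventually_elim (use pos False in \<open>simp add: field_simps\<close>)
          then show ?thesis by (rule tendsto_eventually)
        qed
      qed
    qed simp
    moreover have "K \<inter> circle = K" using K by auto
    ultimately show ?thesis by (simp add: spL)
  qed
  have closed_eq: "measure M K = measure N K" if K: "closed K" "K \<subseteq> circle" for K
  proof (cases "K = {}")
    case False
    have "(\<integral>\<zeta>. max 0 (1 - real n * infdist \<zeta> K) \<partial>M) = (\<integral>\<zeta>. max 0 (1 - real n * infdist \<zeta> K) \<partial>N)"
      for n by (intro eq continuous_intros)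
    with lim[OF K False M] lim[OF K False N] show ?thesis
      by (simp add: LIMSEQ_unique)
  qed simp
  define \<K> where "\<K> = {K. closed K \<and> K \<subseteq> circle}"
  have gen: "sets circle_borel = sigma_sets circle \<K>"
  proof -
    have "sets circle_borel = (\<inter>) circle ` sigma_sets UNIV (Collect closed)"
      unfolding circle_borel_def sets_restrict_space by (simp add: borel_eq_closed)
    also have "\<dots> = sigma_sets circle ((\<inter>) circle ` Collect closed)"
      by (rule sigma_sets_Int) (auto intro: sigma_sets.Basic)
    also have "(\<inter>) circle ` Collect closed = \<K>"
      unfolding \<K>_def by (auto intro!: image_eqI closed_Int)
    finally show ?thesis .
  qed
  show ?thesis
  proof (rule measure_eqI_generator_eq[where E = \<K> and \<Omega> = circle and A = "\<lambda>_. circle"])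
    show "Int_stable \<K>" by (auto simp: Int_stable_def \<K>_def)
    show "emeasure M X = emeasure N X" if "X \<in> \<K>" for X
      using closed_eq that by (simp add: \<K>_def M.emeasure_eq_measure N.emeasure_eq_measure)
  qed (use M N gen in \<open>auto simp: \<K>_def\<close>)
qed

section \<open>Integration against a complex measure\<close>

lemma pos_variation_circle:
  assumes "countably_additive_on circle_borel \<nu>"
  shows "finite_measure (pos_variation circle_borel \<nu>)" "finite_measure (neg_variation circle_borel \<nu>)"
    "sets (pos_variation circle_borel \<nu>) = sets circle_borel"
    "sets (neg_variation circle_borel \<nu>) = sets circle_borel"
  unfolding neg_variation_def
  by (rule finite_measure_pos_variation sets_pos_variation assms
      countably_additive_on_uminus[OF assms])+

text \<open>
  The hypothesis concerns every Borel set off \<open>E\<close>, so no cancellation can hide mass there.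
\<close>
lemma AE_pos_variation_support:
  assumes ca: "countably_additive_on circle_borel \<nu>" and E: "closed E"
    and 0: "\<And>A. A \<in> sets circle_borel \<Longrightarrow> A \<inter> E = {} \<Longrightarrow> \<nu> A = 0"
  shows "AE \<zeta> in pos_variation circle_borel \<nu>. \<zeta> \<in> E"
proof (rule AE_I')
  have C: "circle - E \<in> sets circle_borel"
    using E by (auto simp: sets_circle_borel_iff)
  have "emeasure (pos_variation circle_borel \<nu>) (circle - E) = 0"
  proof -
    have "\<nu> B = 0" if "B \<in> sets circle_borel" "B \<subseteq> circle - E" for B
      using that by (intro 0) auto
    then have "(SUP B\<in>{B \<in> sets circle_borel. B \<subseteq> circle - E}. ennreal (\<nu> B)) \<le> 0"
      by (intro SUP_least) auto
    then show ?thesis by (simp add: emeasure_pos_variation[OF ca C])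
  qed
  then show "circle - E \<in> null_sets (pos_variation circle_borel \<nu>)"
    by (rule null_setsI) (use C in \<open>simp only: sets_pos_variation[OF ca]\<close>)
  show "{\<zeta> \<in> space (pos_variation circle_borel \<nu>). \<zeta> \<notin> E} \<subseteq> circle - E"
    by (simp only: space_pos_variation[OF ca] space_circle_borel) blast
qed

lemma space_variation_circle:
  assumes "countably_additive_on circle_borel \<nu>"
  shows "space (pos_variation circle_borel \<nu>) = circle" "space (neg_variation circle_borel \<nu>) = circle"
proof -
  show "space (pos_variation circle_borel \<nu>) = circle"
    by (rule trans[OF space_pos_variation[OF assms] space_circle_borel])
  show "space (neg_variation circle_borel \<nu>) = circle"
    unfolding neg_variation_def
    by (rule trans[OF space_pos_variation[OF countably_additive_on_uminus[OF assms]] space_circle_borel])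
qed

text \<open>
  Equals the total variation of \<open>\<nu>\<close>, by the Jordan decomposition.
\<close>
definition variation_mass :: "(complex set \<Rightarrow> real) \<Rightarrow> real" where
  "variation_mass \<nu> = measure (pos_variation circle_borel \<nu>) circle + measure (neg_variation circle_borel \<nu>) circle"

lemma norm_signed_integral_le:
  assumes ca: "countably_additive_on circle_borel \<nu>" and E: "closed E"
    and 0: "\<And>A. A \<in> sets circle_borel \<Longrightarrow> A \<inter> E = {} \<Longrightarrow> \<nu> A = 0"
    and B: "0 \<le> B" "\<And>\<zeta>. \<zeta> \<in> E \<Longrightarrow> cmod (F \<zeta>) \<le> B"
  shows "cmod (signed_integral circle_borel \<nu> F) \<le> B * variation_mass \<nu>"
proof -
  note pv = pos_variation_circle[OF ca]
  have 1: "cmod (\<integral>\<zeta>. F \<zeta> \<partial>pos_variation circle_borel \<nu>) \<le> B * measure (pos_variation circle_borel \<nu>) circle"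
    by (rule norm_integral_le_on_circle[OF pv(1,3) B(1)])
      (rule eventually_mono[OF AE_pos_variation_support[OF ca E 0] B(2)])
  have 2: "cmod (\<integral>\<zeta>. F \<zeta> \<partial>neg_variation circle_borel \<nu>) \<le> B * measure (neg_variation circle_borel \<nu>) circle"
  proof (rule norm_integral_le_on_circle[OF pv(2,4) B(1)])
    have "AE \<zeta> in neg_variation circle_borel \<nu>. \<zeta> \<in> E"
      unfolding neg_variation_def
      by (rule AE_pos_variation_support[OF countably_additive_on_uminus[OF ca] E]) (simp add: 0)
    then show "AE \<zeta> in neg_variation circle_borel \<nu>. cmod (F \<zeta>) \<le> B"
      by (rule eventually_mono) (rule B(2))
  qed
  show ?thesis
    unfolding signed_integral_def variation_mass_def distrib_left
    by (rule order_trans[OF norm_triangle_ineq4 add_mono[OF 1 2]])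
qed

lemma norm_complex_measure_integral_le:
  assumes \<mu>: "\<mu> \<in> measures_on E" and E: "closed E"
    and B: "0 \<le> B" "\<And>\<zeta>. \<zeta> \<in> E \<Longrightarrow> cmod (F \<zeta>) \<le> B"
  shows "cmod (complex_measure_integral circle_borel \<mu> F) \<le>
    B * (variation_mass (\<lambda>A. Re (\<mu> A)) + variation_mass (\<lambda>A. Im (\<mu> A)))"
proof -
  have cm: "complex_measure circle_borel \<mu>"
    and 0: "\<And>A. A \<in> sets circle_borel \<Longrightarrow> A \<inter> E = {} \<Longrightarrow> \<mu> A = 0"
    using \<mu> by (auto simp: measures_on_def)
  have "cmod (signed_integral circle_borel (\<lambda>A. Re (\<mu> A)) F) \<le> B * variation_mass (\<lambda>A. Re (\<mu> A))"
    by (rule norm_signed_integral_le[OF complex_measure_Re[OF cm] E _ B]) (simp add: 0)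
  moreover have "cmod (signed_integral circle_borel (\<lambda>A. Im (\<mu> A)) F) \<le> B * variation_mass (\<lambda>A. Im (\<mu> A))"
    by (rule norm_signed_integral_le[OF complex_measure_Im[OF cm] E _ B]) (simp add: 0)
  ultimately show ?thesis
    unfolding complex_measure_integral_def distrib_left
    by (intro order_trans[OF norm_triangle_ineq]) (simp add: norm_mult)
qed

lemma signed_integral_add:
  assumes ca: "countably_additive_on circle_borel \<nu>"
    and FG: "continuous_on circle F" "continuous_on circle G"
  shows "signed_integral circle_borel \<nu> (\<lambda>\<zeta>. F \<zeta> + G \<zeta>) =
    signed_integral circle_borel \<nu> F + signed_integral circle_borel \<nu> G"
proof -
  note pv = pos_variation_circle[OF ca]
  have P: "(\<integral>\<zeta>. F \<zeta> + G \<zeta> \<partial>pos_variation circle_borel \<nu>) =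
      (\<integral>\<zeta>. F \<zeta> \<partial>pos_variation circle_borel \<nu>) + (\<integral>\<zeta>. G \<zeta> \<partial>pos_variation circle_borel \<nu>)"
    by (intro Bochner_Integration.integral_add integrable_of_continuous_on_circle pv FG)
  have N: "(\<integral>\<zeta>. F \<zeta> + G \<zeta> \<partial>neg_variation circle_borel \<nu>) =
      (\<integral>\<zeta>. F \<zeta> \<partial>neg_variation circle_borel \<nu>) + (\<integral>\<zeta>. G \<zeta> \<partial>neg_variation circle_borel \<nu>)"
    by (intro Bochner_Integration.integral_add integrable_of_continuous_on_circle pv FG)
  show ?thesis unfolding signed_integral_def P N by (rule add_diff_add)
qed

lemma complex_measure_integral_add:
  assumes "complex_measure circle_borel \<mu>" "continuous_on circle F" "continuous_on circle G"
  shows "complex_measure_integral circle_borel \<mu> (\<lambda>\<zeta>. F \<zeta> + G \<zeta>) =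
    complex_measure_integral circle_borel \<mu> F + complex_measure_integral circle_borel \<mu> G"
  unfolding complex_measure_integral_def
    signed_integral_add[OF complex_measure_Re[OF assms(1)] assms(2,3)]
    signed_integral_add[OF complex_measure_Im[OF assms(1)] assms(2,3)]
  by (simp add: distrib_left)

lemma complex_measure_integral_cmult:
  "complex_measure_integral circle_borel \<mu> (\<lambda>\<zeta>. c * F \<zeta>) = c * complex_measure_integral circle_borel \<mu> F"
  by (simp add: complex_measure_integral_def signed_integral_def algebra_simps)

lemma complex_measure_integral_cong:
  assumes "complex_measure circle_borel \<mu>" "\<And>\<zeta>. \<zeta> \<in> circle \<Longrightarrow> F \<zeta> = G \<zeta>"
  shows "complex_measure_integral circle_borel \<mu> F = complex_measure_integral circle_borel \<mu> G"
proof -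
  have *: "signed_integral circle_borel \<nu> F = signed_integral circle_borel \<nu> G"
    if "countably_additive_on circle_borel \<nu>" for \<nu>
    unfolding signed_integral_def
    by (intro arg_cong2[where f = minus] Bochner_Integration.integral_cong refl)
      (simp_all only: space_variation_circle[OF that] assms(2))
  show ?thesis
    unfolding complex_measure_integral_def
    by (simp add: *[OF complex_measure_Re[OF assms(1)]] *[OF complex_measure_Im[OF assms(1)]])
qed

lemma complex_measure_integral_sum:
  assumes cm: "complex_measure circle_borel \<mu>" and "finite I" "\<And>i. i \<in> I \<Longrightarrow> continuous_on circle (F i)"
  shows "complex_measure_integral circle_borel \<mu> (\<lambda>\<zeta>. \<Sum>i\<in>I. F i \<zeta>) =
    (\<Sum>i\<in>I. complex_measure_integral circle_borel \<mu> (F i))"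
  using assms(2,3)
proof (induction I rule: finite_induct)
  case empty
  show ?case by (simp add: complex_measure_integral_def signed_integral_def)
next
  case (insert i I)
  then show ?case
    by (simp add: complex_measure_integral_add[OF cm] continuous_on_sum)
qed

text \<open>
  Both variations have the same integrals of trigonometric polynomials, hence, by density, of
  all continuous functions, so they coincide and cancel.
\<close>
lemma signed_measure_eq_0:
  assumes ca: "countably_additive_on circle_borel \<nu>"
    and 0: "\<And>p :: complex \<Rightarrow> real. trig_poly (\<lambda>\<zeta>. complex_of_real (p \<zeta>)) \<Longrightarrow>
      (\<integral>\<zeta>. p \<zeta> \<partial>pos_variation circle_borel \<nu>) = (\<integral>\<zeta>. p \<zeta> \<partial>neg_variation circle_borel \<nu>)"
    and A: "A \<in> sets circle_borel"
  shows "\<nu> A = 0"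
proof -
  let ?P = "pos_variation circle_borel \<nu>" and ?N = "neg_variation circle_borel \<nu>"
  note pv = pos_variation_circle[OF ca]
  have "?P = ?N"
  proof (rule finite_measure_eqI_continuous[OF pv(1,3) pv(2,4)])
    fix f :: "complex \<Rightarrow> real" assume f: "continuous_on circle f"
    define V where "V = variation_mass \<nu>"
    have V: "V \<ge> 0" by (simp add: V_def variation_mass_def)
    have "\<bar>(\<integral>\<zeta>. f \<zeta> \<partial>?P) - (\<integral>\<zeta>. f \<zeta> \<partial>?N)\<bar> \<le> e" if e: "e > 0" for e
    proof -
      define \<delta> where "\<delta> = e / (1 + V)"
      have \<delta>: "\<delta> > 0" using e V by (simp add: \<delta>_def)
      obtain p where p: "trig_poly (\<lambda>\<zeta>. complex_of_real (p \<zeta>))"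
          "\<And>\<zeta>. \<zeta> \<in> circle \<Longrightarrow> \<bar>f \<zeta> - p \<zeta>\<bar> < \<delta>"
        using trig_poly_dense[OF f \<delta>] by blast
      have "continuous_on circle (\<lambda>\<zeta>. Re (complex_of_real (p \<zeta>)))"
        by (intro continuous_intros trig_poly_continuous p)
      then have pc: "continuous_on circle p" by simp
      have int: "integrable ?P f" "integrable ?P p" "integrable ?N f" "integrable ?N p"
        by (rule integrable_of_continuous_on_circle pv f pc)+
      have near: "AE \<zeta> in M. norm (f \<zeta> - p \<zeta>) \<le> \<delta>" if "sets M = sets circle_borel" for M
      proof (rule AE_I2)
        fix \<zeta> assume "\<zeta> \<in> space M"
        then have "\<zeta> \<in> circle" using sets_eq_imp_space_eq[OF that] by simp
        then show "norm (f \<zeta> - p \<zeta>) \<le> \<delta>" using p(2) by (simp add: less_imp_le)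
      qed
      have bP: "norm (\<integral>\<zeta>. f \<zeta> - p \<zeta> \<partial>?P) \<le> \<delta> * measure ?P circle"
        by (rule norm_integral_le_on_circle[OF pv(1,3) less_imp_le[OF \<delta>] near[OF pv(3)]])
      have bN: "norm (\<integral>\<zeta>. f \<zeta> - p \<zeta> \<partial>?N) \<le> \<delta> * measure ?N circle"
        by (rule norm_integral_le_on_circle[OF pv(2,4) less_imp_le[OF \<delta>] near[OF pv(4)]])
      have "\<bar>x - y\<bar> \<le> \<delta> * a + \<delta> * b" if "norm (x - z) \<le> \<delta> * a" "norm (y - z) \<le> \<delta> * b" for x y z a b :: real
        using that by simp
      from this[OF bP[unfolded Bochner_Integration.integral_diff[OF int(1,2)] 0[OF p(1)]]
          bN[unfolded Bochner_Integration.integral_diff[OF int(3,4)]]]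
      have "\<bar>(\<integral>\<zeta>. f \<zeta> \<partial>?P) - (\<integral>\<zeta>. f \<zeta> \<partial>?N)\<bar> \<le> \<delta> * V"
        unfolding V_def variation_mass_def distrib_left .
      also have "\<delta> * V \<le> e" using e V by (simp add: \<delta>_def field_simps)
      finally show ?thesis .
    qed
    then have "\<bar>(\<integral>\<zeta>. f \<zeta> \<partial>?P) - (\<integral>\<zeta>. f \<zeta> \<partial>?N)\<bar> \<le> 0"
      by (rule field_le_epsilon) (simp only: add_0_left)
    then show "(\<integral>\<zeta>. f \<zeta> \<partial>?P) = (\<integral>\<zeta>. f \<zeta> \<partial>?N)" by simp
  qed
  then show ?thesis by (subst jordan_decomposition[OF ca A]) (simp only: diff_self)
qed

text \<open>
  Integrals of trigonometric polynomials vanish by linearity. Testing with real-valued ones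
  separates the real from the imaginary part of \<open>\<mu>\<close>.
\<close>
lemma complex_measure_eq_0:
  assumes cm: "complex_measure circle_borel \<mu>" and 0: "\<And>k. fourier_coeff_measure \<mu> k = 0"
    and A: "A \<in> sets circle_borel"
  shows "\<mu> A = 0"
proof -
  have tp: "complex_measure_integral circle_borel \<mu> F = 0" if "trig_poly F" for F
    using that
  proof (induction rule: trig_poly.induct)
    case (monomial F c k)
    have "complex_measure_integral circle_borel \<mu> F =
        complex_measure_integral circle_borel \<mu> (\<lambda>\<zeta>. c * \<zeta> powi (- (- k)))"
      by (rule complex_measure_integral_cong[OF cm]) (simp add: monomial)
    then show ?case
      using 0[of "- k"] by (simp only: complex_measure_integral_cmult fourier_coeff_measure_def) simp
  next
    case (add F G H)
    have "complex_measure_integral circle_borel \<mu> H =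
        complex_measure_integral circle_borel \<mu> (\<lambda>\<zeta>. F \<zeta> + G \<zeta>)"
      by (rule complex_measure_integral_cong[OF cm]) (simp add: add)
    then show ?case
      using add by (simp add: complex_measure_integral_add[OF cm] trig_poly_continuous)
  qed
  have *: "(\<integral>\<zeta>. p \<zeta> \<partial>pos_variation circle_borel (\<lambda>A. Re (\<mu> A))) = (\<integral>\<zeta>. p \<zeta> \<partial>neg_variation circle_borel (\<lambda>A. Re (\<mu> A)))"
    "(\<integral>\<zeta>. p \<zeta> \<partial>pos_variation circle_borel (\<lambda>A. Im (\<mu> A))) = (\<integral>\<zeta>. p \<zeta> \<partial>neg_variation circle_borel (\<lambda>A. Im (\<mu> A)))"
    if "trig_poly (\<lambda>\<zeta>. complex_of_real (p \<zeta>))" for p :: "complex \<Rightarrow> real"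
    using tp[OF that] by (simp_all add: complex_measure_integral_def signed_integral_def complex_eq_iff)
  have "Re (\<mu> A) = 0" "Im (\<mu> A) = 0"
    using signed_measure_eq_0[OF complex_measure_Re[OF cm] * (1) A]
      signed_measure_eq_0[OF complex_measure_Im[OF cm] * (2) A] by auto
  then show ?thesis by (simp add: complex_eq_iff)
qed

section \<open>Uniqueness from one-sided decay\<close>

text \<open>
  For \<open>0 < b < r < 1\<close> the function \<open>s z = (1 - b * z) / (1 - r * z)\<close> has constant term \<open>1\<close>, and
  on the circle \<open>cmod (s z) < 1\<close> holds exactly when \<open>2 * Re z < r + b\<close>. Choosing \<open>b\<close> above \<open>\<kappa>\<close> makes
  \<open>cmod (s z)\<close> uniformly less than \<open>1\<close> for \<open>Re z \<le> \<kappa>\<close>. A Taylor polynomial of \<open>s\<close> inherits this, and a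
  high power of it is as small as desired, still with constant term \<open>1\<close>.
\<close>
lemma poly_small_off_arc:
  fixes \<kappa> \<delta> :: real
  assumes \<kappa>: "\<kappa> < 1" and \<delta>: "0 < \<delta>"
  shows "\<exists>q :: complex poly. poly q 0 = 1 \<and>
    (\<forall>z\<in>circle. Re z \<le> \<kappa> \<longrightarrow> cmod (poly q z) \<le> \<delta>)"
proof -
  obtain b where b: "max \<kappa> 0 < b" "b < 1" using \<kappa> dense[of "max \<kappa> 0" 1] by auto
  obtain r where r: "b < r" "r < 1" using b dense[of b 1] by auto
  define \<rho> where "\<rho> = 1 - (r - b) * (r + b - 2 * max \<kappa> 0) / 4"
  have gap: "(r - b) * (r + b - 2 * max \<kappa> 0) > 0" using b r by (intro mult_pos_pos) auto
  then have \<rho>1: "\<rho> < 1" by (simp add: \<rho>_def)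
  have "(r - b) * (r + b - 2 * max \<kappa> 0) \<le> 1 * 2" using b r by (intro mult_mono) auto
  then have \<rho>0: "0 \<le> \<rho>" by (simp add: \<rho>_def)
  define \<sigma> where "\<sigma> = sqrt \<rho>"
  have \<sigma>: "0 \<le> \<sigma>" "\<sigma> < 1" using \<rho>0 \<rho>1 by (auto simp: \<sigma>_def)
  have "(\<lambda>d. (r - b) / (1 - r) * r ^ d) \<longlonglongrightarrow> (r - b) / (1 - r) * 0"
    by (intro tendsto_intros LIMSEQ_power_zero) (use b r in auto)
  then have "eventually (\<lambda>d. (r - b) / (1 - r) * r ^ d < (1 - \<sigma>) / 2) sequentially"
    using \<sigma> by (intro order_tendstoD(2)) auto
  then obtain d where d: "(r - b) / (1 - r) * r ^ d < (1 - \<sigma>) / 2"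
    by (auto simp: eventually_sequentially)
  have "(\<lambda>M. ((1 + \<sigma>) / 2) ^ M) \<longlonglongrightarrow> 0" using \<sigma> by (intro LIMSEQ_power_zero) auto
  then have "eventually (\<lambda>M. ((1 + \<sigma>) / 2) ^ M < \<delta>) sequentially"
    using \<delta> by (rule order_tendstoD(2))
  then obtain M where M: "((1 + \<sigma>) / 2) ^ M < \<delta>" by (auto simp: eventually_sequentially)
  define p :: "complex poly" where
    "p = 1 + smult (of_real (r - b)) (pCons 0 (\<Sum>n<d. monom (of_real r ^ n) n))"
  have pz: "poly p z = 1 + of_real (r - b) * z * (\<Sum>n<d. (of_real r * z) ^ n)" for z
    by (simp add: p_def poly_sum poly_monom power_mult_distrib mult.assoc)
  have small: "cmod (poly p z) \<le> (1 + \<sigma>) / 2" if z: "z \<in> circle" "Re z \<le> \<kappa>" for z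
  proof -
    have nz: "cmod z = 1" using z by simp
    define w where "w = of_real r * z"
    have "cmod w = r" using nz b r by (simp add: w_def norm_mult)
    have lower: "1 - r \<le> cmod (1 - w)"
      using norm_triangle_ineq2[of 1 w] \<open>cmod w = r\<close> by simp
    have upper: "cmod (1 - w) \<le> 2"
      using norm_triangle_ineq4[of 1 w] \<open>cmod w = r\<close> r by simp
    have w1: "w \<noteq> 1" using \<open>cmod w = r\<close> r by auto
    have quad: "(cmod (1 - of_real t * z))\<^sup>2 = 1 + t\<^sup>2 - 2 * t * Re z" for t
    proof -
      have "(Re z)\<^sup>2 + (Im z)\<^sup>2 = 1" using nz cmod_power2[of z] by simp
      then have "t\<^sup>2 * (Re z)\<^sup>2 + t\<^sup>2 * (Im z)\<^sup>2 = t\<^sup>2" by (metis distrib_left mult.right_neutral)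
      then show ?thesis by (simp add: cmod_power2 power2_diff power_mult_distrib)
    qed
    have "(cmod (1 - w))\<^sup>2 - (cmod (1 - of_real b * z))\<^sup>2 = (r - b) * (r + b - 2 * Re z)"
      unfolding w_def quad by (simp add: algebra_simps power2_eq_square)
    also have "\<dots> \<ge> (r - b) * (r + b - 2 * max \<kappa> 0)"
      using z r by (intro mult_left_mono) auto
    also have "(r - b) * (r + b - 2 * max \<kappa> 0) = (1 - \<rho>) * 4" by (simp add: \<rho>_def)
    also have "(1 - \<rho>) * 4 \<ge> (1 - \<rho>) * (cmod (1 - w))\<^sup>2"
      using \<rho>1 power_mono[OF upper, of 2] by (intro mult_left_mono) auto
    finally have "(cmod (1 - of_real b * z))\<^sup>2 \<le> (\<sigma> * cmod (1 - w))\<^sup>2"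
      using \<rho>0 by (simp add: \<sigma>_def power_mult_distrib algebra_simps)
    then have s: "cmod (1 - of_real b * z) \<le> \<sigma> * cmod (1 - w)"
      using \<sigma> by (auto intro: power2_le_imp_le)
    have "poly p z = ((1 - of_real b * z) - of_real (r - b) * z * w ^ d) / (1 - w)"
      unfolding pz w_def[symmetric] using w1
      by (simp add: geometric_sum field_simps) (simp add: w_def algebra_simps)
    also have "cmod \<dots> = cmod ((1 - of_real b * z) - of_real (r - b) * z * w ^ d) / cmod (1 - w)"
      by (simp add: norm_divide)
    also have "\<dots> \<le> (\<sigma> * cmod (1 - w) + (r - b) * r ^ d) / cmod (1 - w)"
    proof (rule divide_right_mono)
      have "cmod (of_real (r - b) * z * w ^ d) \<le> (r - b) * r ^ d"
        using r by (simp add: norm_mult norm_power nz \<open>cmod w = r\<close> del: of_real_diff)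
      from order_trans[OF norm_triangle_ineq4 add_mono[OF s this]]
      show "cmod ((1 - of_real b * z) - of_real (r - b) * z * w ^ d) \<le> \<sigma> * cmod (1 - w) + (r - b) * r ^ d" .
    qed simp
    also have "\<dots> = \<sigma> + (r - b) * r ^ d / cmod (1 - w)" using w1 by (simp add: add_divide_distrib)
    also have "\<dots> \<le> \<sigma> + (r - b) * r ^ d / (1 - r)"
      using b r lower by (intro add_left_mono divide_left_mono mult_pos_pos) auto
    also have "\<dots> \<le> (1 + \<sigma>) / 2" using d by (simp add: field_simps)
    finally show ?thesis .
  qed
  show ?thesis
  proof (intro exI[of _ "p ^ M"] conjI ballI impI)
    show "poly (p ^ M) 0 = 1" by (simp add: poly_power pz)
    fix z :: complex assume z: "z \<in> circle" "Re z \<le> \<kappa>"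
    have "cmod (poly (p ^ M) z) \<le> ((1 + \<sigma>) / 2) ^ M"
      unfolding poly_power norm_power by (intro power_mono small z) simp
    then show "cmod (poly (p ^ M) z) \<le> \<delta>" using M by simp
  qed
qed

text \<open>
  Integrating \<open>\<zeta> powi (-k) * poly q (cnj (\<zeta> ^ N))\<close> against \<open>\<mu>\<close> gives the coefficient at \<open>k\<close>, from the
  constant term \<open>1\<close> of \<open>q\<close>, plus a combination of the coefficients at \<open>k + n * N\<close> with \<open>n \<ge> 1\<close>. The
  integrand is small on \<open>E\<close>, hence so is the integral.
\<close>
lemma fourier_coeff_measure_poly_bound:
  assumes \<mu>: "\<mu> \<in> measures_on E" and E: "closed E" "E \<subseteq> circle"
    and q: "poly q 0 = 1" "\<And>z. z \<in> circle \<Longrightarrow> Re z \<le> \<kappa> \<Longrightarrow> cmod (poly q z) \<le> \<delta>"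
    and EN: "\<And>\<zeta>. \<zeta> \<in> E \<Longrightarrow> Re (\<zeta> ^ N) \<le> \<kappa>" and \<delta>: "0 \<le> \<delta>"
  shows "cmod (fourier_coeff_measure \<mu> k) \<le>
    \<delta> * (variation_mass (\<lambda>A. Re (\<mu> A)) + variation_mass (\<lambda>A. Im (\<mu> A))) +
    (\<Sum>n=1..degree q. cmod (coeff q n) * cmod (fourier_coeff_measure \<mu> (k + int (n * N))))"
proof -
  have cm: "complex_measure circle_borel \<mu>" using \<mu> by (auto simp: measures_on_def)
  define F where "F n \<zeta> = coeff q n * \<zeta> powi (- (k + int (n * N)))" for n \<zeta>
  have F: "continuous_on circle (F n)" for n
    unfolding F_def by (intro continuous_intros) (auto simp: circle_nonzero)
  have F_int: "complex_measure_integral circle_borel \<mu> (F n) =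
      coeff q n * fourier_coeff_measure \<mu> (k + int (n * N))" for n
    unfolding F_def fourier_coeff_measure_def complex_measure_integral_cmult ..
  have sum: "(\<Sum>n\<le>degree q. F n \<zeta>) = \<zeta> powi (- k) * poly q (cnj (\<zeta> ^ N))" if "\<zeta> \<in> circle" for \<zeta>
  proof -
    have "cnj (\<zeta> ^ N) = inverse (\<zeta> ^ N)"
      using that by (intro inverse_unique[symmetric])
        (simp add: complex_norm_square[symmetric] norm_power del: complex_cnj_power)
    then have pow: "\<zeta> powi (- int (n * N)) = cnj (\<zeta> ^ N) ^ n" for n
      by (simp only: power_int_minus power_int_of_nat power_mult mult.commute[of n] power_inverse)
    have "\<zeta> powi (- (k + int (n * N))) = \<zeta> powi (- k) * cnj (\<zeta> ^ N) ^ n" for n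
      unfolding minus_add_distrib pow[symmetric]
      by (rule power_int_add) (use circle_nonzero[OF that] in blast)
    then show ?thesis
      by (simp add: F_def poly_altdef sum_distrib_left mult_ac)
  qed
  have "cmod (complex_measure_integral circle_borel \<mu> (\<lambda>\<zeta>. \<Sum>n\<le>degree q. F n \<zeta>)) \<le>
      \<delta> * (variation_mass (\<lambda>A. Re (\<mu> A)) + variation_mass (\<lambda>A. Im (\<mu> A)))"
  proof (rule norm_complex_measure_integral_le[OF \<mu> E(1) \<delta>])
    fix \<zeta> assume \<zeta>: "\<zeta> \<in> E"
    then have c: "\<zeta> \<in> circle" using E by auto
    have "cmod (poly q (cnj (\<zeta> ^ N))) \<le> \<delta>"
      using EN[OF \<zeta>] c by (intro q) (auto simp: norm_power simp del: complex_cnj_power)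
    then show "cmod (\<Sum>n\<le>degree q. F n \<zeta>) \<le> \<delta>"
      by (simp add: sum[OF c] norm_mult norm_powi_circle[OF c])
  qed
  also have "complex_measure_integral circle_borel \<mu> (\<lambda>\<zeta>. \<Sum>n\<le>degree q. F n \<zeta>) =
      (\<Sum>n\<le>degree q. coeff q n * fourier_coeff_measure \<mu> (k + int (n * N)))"
    by (simp add: complex_measure_integral_sum[OF cm] F F_int)
  also have "\<dots> = fourier_coeff_measure \<mu> k +
      (\<Sum>n=1..degree q. coeff q n * fourier_coeff_measure \<mu> (k + int (n * N)))"
    using q(1) by (simp add: atMost_atLeast0 sum.atLeast_Suc_atMost poly_0_coeff_0)
  finally have "cmod (fourier_coeff_measure \<mu> k +
      (\<Sum>n=1..degree q. coeff q n * fourier_coeff_measure \<mu> (k + int (n * N)))) \<le>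
      \<delta> * (variation_mass (\<lambda>A. Re (\<mu> A)) + variation_mass (\<lambda>A. Im (\<mu> A)))" .
  moreover have "cmod (\<Sum>n=1..degree q. coeff q n * fourier_coeff_measure \<mu> (k + int (n * N))) \<le>
      (\<Sum>n=1..degree q. cmod (coeff q n) * cmod (fourier_coeff_measure \<mu> (k + int (n * N))))"
    by (rule order_trans[OF norm_sum]) (simp add: norm_mult)
  ultimately show ?thesis
    using norm_triangle_ineq4[of "fourier_coeff_measure \<mu> k +
      (\<Sum>n=1..degree q. coeff q n * fourier_coeff_measure \<mu> (k + int (n * N)))"
      "\<Sum>n=1..degree q. coeff q n * fourier_coeff_measure \<mu> (k + int (n * N))"] by simp
qed

text \<open>
  For fixed \<open>k\<close> and \<open>j \<ge> \<bar>k\<bar>\<close>, all frequencies \<open>k + n * N j\<close> with \<open>n \<ge> 1\<close> are at least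
  \<open>N j - j > 0\<close>, so that the given one-sided bound controls the second term of the previous estimate.
  Letting \<open>j\<close> tend to infinity shows that every Fourier coefficient vanishes, including those at
  \<open>k \<le> 0\<close>.
\<close>
lemma measures_on_eq_0_of_unilateral_bound:
  fixes \<Omega> :: "nat \<Rightarrow> real" and q :: "nat \<Rightarrow> complex poly"
  assumes E: "closed E" "E \<subseteq> circle"
    and q: "\<And>j. poly (q j) 0 = 1"
      "\<And>j z. z \<in> circle \<Longrightarrow> Re z \<le> \<kappa> j \<Longrightarrow> cmod (poly (q j) z) \<le> 1 / 2 ^ j"
    and EN: "\<And>j \<zeta>. \<zeta> \<in> E \<Longrightarrow> Re (\<zeta> ^ N j) \<le> \<kappa> j"
    and N: "\<And>j. j < N j"
    and \<Omega>: "\<And>j n. N j - j \<le> n \<Longrightarrow> (\<Sum>i=1..degree (q j). cmod (coeff (q j) i)) * \<Omega> n \<le> 1 / 2 ^ j"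
    and \<mu>: "\<mu> \<in> measures_on E"
    and bound: "\<And>n. n \<ge> 1 \<Longrightarrow> cmod (fourier_coeff_measure \<mu> (int n)) \<le> \<Omega> n"
    and A: "A \<in> sets circle_borel"
  shows "\<mu> A = 0"
proof (rule complex_measure_eq_0[OF _ _ A])
  show cm: "complex_measure circle_borel \<mu>" using \<mu> by (auto simp: measures_on_def)
  fix k
  define V where "V = variation_mass (\<lambda>A. Re (\<mu> A)) + variation_mass (\<lambda>A. Im (\<mu> A))"
  have le: "cmod (fourier_coeff_measure \<mu> k) \<le> (V + 1) * (1 / 2) ^ j" if j: "j \<ge> nat \<bar>k\<bar>" for j
  proof -
    define S where "S = (\<Sum>i=1..degree (q j). cmod (coeff (q j) i))"
    have each: "S * cmod (fourier_coeff_measure \<mu> (k + int (n * N j))) \<le> 1 / 2 ^ j"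
      if n: "n \<ge> 1" for n
    proof -
      have "int (N j) - int j \<le> k + int (n * N j)"
      proof -
        have "N j \<le> n * N j" using n by simp
        then show ?thesis using j by linarith
      qed
      moreover define m where "m = nat (k + int (n * N j))"
      ultimately have m: "N j - j \<le> m" "k + int (n * N j) = int m" "m \<ge> 1"
        using N[of j] by auto
      have "S * cmod (fourier_coeff_measure \<mu> (int m)) \<le> S * \<Omega> m"
        unfolding S_def by (intro mult_left_mono bound m sum_nonneg) auto
      also have "\<dots> \<le> 1 / 2 ^ j" unfolding S_def by (rule \<Omega>[OF m(1)])
      finally show ?thesis unfolding m(2) .
    qed
    have "(\<Sum>n=1..degree (q j). cmod (coeff (q j) n) * cmod (fourier_coeff_measure \<mu> (k + int (n * N j)))) \<le> 1 / 2 ^ j"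
    proof (cases "S = 0")
      case True
      then have "cmod (coeff (q j) n) = 0" if "n \<in> {1..degree (q j)}" for n
        using that unfolding S_def by (subst (asm) sum_nonneg_eq_0_iff) auto
      then show ?thesis by simp
    next
      case False
      then have S: "S > 0" unfolding S_def by (metis less_eq_real_def norm_ge_zero sum_nonneg)
      have "(\<Sum>n=1..degree (q j). cmod (coeff (q j) n) * cmod (fourier_coeff_measure \<mu> (k + int (n * N j))))
          \<le> (\<Sum>n=1..degree (q j). cmod (coeff (q j) n) * (1 / 2 ^ j / S))"
      proof (intro sum_mono mult_left_mono)
        fix n assume "n \<in> {1..degree (q j)}"
        then have "S * cmod (fourier_coeff_measure \<mu> (k + int (n * N j))) \<le> 1 / 2 ^ j"
          by (intro each) auto
        then show "cmod (fourier_coeff_measure \<mu> (k + int (n * N j))) \<le> 1 / 2 ^ j / S"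
          unfolding pos_le_divide_eq[OF S] by (subst mult.commute)
      qed simp
      also have "\<dots> = S * (1 / 2 ^ j / S)" unfolding S_def by (simp only: sum_distrib_right)
      finally show ?thesis using S by simp
    qed
    moreover have "cmod (fourier_coeff_measure \<mu> k) \<le> 1 / 2 ^ j * V +
        (\<Sum>n=1..degree (q j). cmod (coeff (q j) n) * cmod (fourier_coeff_measure \<mu> (k + int (n * N j))))"
      unfolding V_def by (rule fourier_coeff_measure_poly_bound[OF \<mu> E q EN]) simp_all
    ultimately
    show ?thesis by (simp add: distrib_right power_one_over add_divide_distrib)
  qed
  have "(\<lambda>j. (V + 1) * (1 / 2) ^ j) \<longlonglongrightarrow> (V + 1) * 0"
    by (intro tendsto_intros LIMSEQ_power_zero) auto
  then have "cmod (fourier_coeff_measure \<mu> k) \<le> (V + 1) * 0"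
    by (rule LIMSEQ_le_const) (use le in blast)
  then show "fourier_coeff_measure \<mu> k = 0" by simp
qed

section \<open>Fourier coefficients of continuous functions\<close>

lemma finite_measure_circle_lebesgue: "finite_measure circle_lebesgue"
  by (rule finite_measureI) (simp add: emeasure_circle_lebesgue_space)

lemma measure_circle_lebesgue_circle: "measure circle_lebesgue circle = 1"
  by (simp add: measure_def emeasure_circle_lebesgue_space)

lemmas integrable_circle_continuous =
  integrable_of_continuous_on_circle[OF finite_measure_circle_lebesgue sets_circle_lebesgue]

lemma norm_integral_circle_le:
  fixes F :: "complex \<Rightarrow> 'b::{banach, second_countable_topology}"
  assumes "\<And>\<zeta>. \<zeta> \<in> circle \<Longrightarrow> norm (F \<zeta>) \<le> B"
  shows "norm (\<integral>\<zeta>. F \<zeta> \<partial>circle_lebesgue) \<le> B"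
proof -
  have "norm (F 1) \<le> B" by (rule assms) simp
  then have "0 \<le> B" using norm_ge_zero order_trans by blast
  then have "norm (\<integral>\<zeta>. F \<zeta> \<partial>circle_lebesgue) \<le> B * measure circle_lebesgue circle"
    by (rule norm_integral_le_on_circle[OF finite_measure_circle_lebesgue sets_circle_lebesgue])
      (rule AE_I2, rule assms, simp)
  then show ?thesis by (simp add: measure_circle_lebesgue_circle)
qed

lemma circle_parametrization:
  assumes "\<zeta> \<in> circle" obtains t where "t \<in> {0..1}" "\<zeta> = cis (2 * pi * t)"
proof
  show "Arg2pi \<zeta> / (2 * pi) \<in> {0..1}"
    using Arg2pi_ge_0[of \<zeta>] Arg2pi_lt_2pi[of \<zeta>] by (simp add: field_simps)
  show "\<zeta> = cis (2 * pi * (Arg2pi \<zeta> / (2 * pi)))"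
    using assms complex_norm_eq_1_exp[of \<zeta>] by (simp add: cis_conv_exp)
qed

text \<open>
  Coefficients are computed with the fundamental theorem of calculus, which lives on the closed
  unit interval of the parameter.
\<close>
lemma has_integral_circle:
  fixes F :: "complex \<Rightarrow> 'b::euclidean_space"
  assumes F: "continuous_on circle F"
  shows "((\<lambda>t. F (cis (2 * pi * t))) has_integral (\<integral>\<zeta>. F \<zeta> \<partial>circle_lebesgue)) {0..1}"
proof -
  have G: "continuous_on S (\<lambda>t. F (cis (2 * pi * t)))" for S
    by (rule continuous_on_compose2[OF F]) (auto intro!: continuous_intros)
  have int: "set_integrable lborel {0..1} (\<lambda>t. F (cis (2 * pi * t)))"
    unfolding set_integrable_def by (rule borel_integrable_compact[OF _ G]) simp
  have "(\<integral>\<zeta>. F \<zeta> \<partial>circle_lebesgue) =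
      (\<integral>t. F (cis (2 * pi * t)) \<partial>restrict_space lborel {0..<1})"
    unfolding circle_lebesgue_def
    by (rule integral_distr[OF measurable_cis_circle measurable_of_continuous_on_circle[OF F]])
  also have "\<dots> = (\<integral>t. indicator {0..<1} t *\<^sub>R F (cis (2 * pi * t)) \<partial>lborel)"
    by (rule integral_restrict_space) simp
  also have "\<dots> = (\<integral>t. indicator {0..1} t *\<^sub>R F (cis (2 * pi * t)) \<partial>lborel)"
  proof (rule integral_cong_AE)
    show "AE t in lborel. indicator {0..<1} t *\<^sub>R F (cis (2 * pi * t)) = indicator {0..1} t *\<^sub>R F (cis (2 * pi * t))"
      using AE_lborel_singleton[of "1::real"] by eventually_elim (auto simp: indicator_def)
    have "(\<lambda>t. F (cis (2 * pi * t))) \<in> borel_measurable borel"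
      by (rule borel_measurable_continuous_onI[OF G])
    then show "(\<lambda>t. indicator {0..<1} t *\<^sub>R F (cis (2 * pi * t))) \<in> borel_measurable lborel"
      "(\<lambda>t. indicator {0..1} t *\<^sub>R F (cis (2 * pi * t))) \<in> borel_measurable lborel"
      by measurable
  qed
  also have "\<dots> = integral {0..1} (\<lambda>t. F (cis (2 * pi * t)))"
    using set_borel_integral_eq_integral(2)[OF int] by (simp add: set_lebesgue_integral_def)
  finally show ?thesis
    using set_borel_integral_eq_integral(1)[OF int] by (simp add: has_integral_iff)
qed

lemma has_integral_affine_cis:
  fixes \<alpha> \<beta> a u v :: real
  assumes a: "a \<noteq> 0" and uv: "u \<le> v"
  defines "G \<equiv> \<lambda>t. cis (- (a * t)) * (\<i> * of_real (\<alpha> + \<beta> * t) / of_real a + of_real \<beta> / of_real a ^ 2)"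
  shows "((\<lambda>t. of_real (\<alpha> + \<beta> * t) * cis (- (a * t))) has_integral (G v - G u)) {u..v}"
proof (rule fundamental_theorem_of_calculus[OF uv])
  fix t assume "t \<in> {u..v}"
  define H where "H z = exp (- (\<i> * of_real a * z)) *
    (\<i> * (of_real \<alpha> + of_real \<beta> * z) / of_real a + of_real \<beta> / of_real a ^ 2)" for z
  have "(H has_field_derivative
      (of_real \<alpha> + of_real \<beta> * of_real t) * exp (- (\<i> * of_real a * of_real t))) (at (of_real t))"
    unfolding H_def using a
    by (auto intro!: derivative_eq_intros simp: field_simps power2_eq_square)
  from has_vector_derivative_real_field[OF this]
  have "((\<lambda>x. H (of_real x)) has_vector_derivative
     (of_real \<alpha> + of_real \<beta> * of_real t) * exp (- (\<i> * of_real a * of_real t))) (at t within {u..v})" .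
  moreover have "(\<lambda>x. H (of_real x)) = G"
    by (rule ext) (simp add: H_def G_def cis_conv_exp mult_ac)
  ultimately show "(G has_vector_derivative of_real (\<alpha> + \<beta> * t) * cis (- (a * t))) (at t within {u..v})"
    by (simp add: cis_conv_exp mult_ac)
qed

lemma cis_2pi_int: "cis (2 * pi * of_int k) = 1"
  by (simp add: cis_conv_exp exp_eq_1)

lemma integral_powi: "(\<integral>\<zeta>. \<zeta> powi k \<partial>circle_lebesgue) = (if k = 0 then 1 else 0)"
proof (cases "k = 0")
  case True
  then show ?thesis by (simp add: measure_circle_lebesgue_circle)
next
  case False
  define a where "a = - (2 * pi * of_int k)"
  have a: "a \<noteq> 0" using False by (simp add: a_def)
  have "continuous_on circle (\<lambda>\<zeta>. \<zeta> powi k)" by (intro continuous_intros) (auto simp: circle_nonzero)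
  then have 1: "((\<lambda>t. cis (2 * pi * t) powi k) has_integral (\<integral>\<zeta>. \<zeta> powi k \<partial>circle_lebesgue)) {0..1}"
    by (rule has_integral_circle)
  have "cis (- a) = 1" unfolding a_def using cis_2pi_int[of k] by simp
  then have "((\<lambda>t. of_real (1 + 0 * t) * cis (- (a * t))) has_integral 0) {0..1}"
    using has_integral_affine_cis[OF a, of 0 1 1 0] by simp
  then have "((\<lambda>t. cis (2 * pi * t) powi k) has_integral 0) {0..1}"
    by (simp add: a_def cis_power_int mult_ac)
  then show ?thesis using has_integral_unique[OF 1] False by auto
qed

lemma continuous_on_mult_powi: "continuous_on circle F \<Longrightarrow> continuous_on circle (\<lambda>\<zeta>. F \<zeta> * \<zeta> powi k)"
  by (intro continuous_intros) (auto simp: circle_nonzero)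

lemma fourier_coeff_diff:
  assumes "continuous_on circle F" "continuous_on circle G"
  shows "fourier_coeff (\<lambda>\<zeta>. F \<zeta> - G \<zeta>) n = fourier_coeff F n - fourier_coeff G n"
  unfolding fourier_coeff_def left_diff_distrib
  by (intro Bochner_Integration.integral_diff integrable_circle_continuous continuous_on_mult_powi assms)

lemma fourier_coeff_cmult: "fourier_coeff (\<lambda>\<zeta>. c * F \<zeta>) n = c * fourier_coeff F n"
  by (simp add: fourier_coeff_def mult.assoc)

lemma fourier_coeff_sum:
  assumes "finite I" "\<And>i. i \<in> I \<Longrightarrow> continuous_on circle (F i)"
  shows "fourier_coeff (\<lambda>\<zeta>. \<Sum>i\<in>I. F i \<zeta>) n = (\<Sum>i\<in>I. fourier_coeff (F i) n)"
  unfolding fourier_coeff_def sum_distrib_right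
  by (intro Bochner_Integration.integral_sum integrable_circle_continuous continuous_on_mult_powi assms(2))

lemma fourier_coeff_mult_powi: "fourier_coeff (\<lambda>\<zeta>. F \<zeta> * \<zeta> powi k) n = fourier_coeff F (n - k)"
  unfolding fourier_coeff_def
  by (intro Bochner_Integration.integral_cong refl)
    (auto simp: circle_nonzero power_int_diff power_int_minus field_simps)

lemma fourier_coeff_powi: "fourier_coeff (\<lambda>\<zeta>. \<zeta> powi k) n = (if n = k then 1 else 0)"
  using fourier_coeff_mult_powi[of "\<lambda>_. 1" k n] integral_powi[of "- (n - k)"]
  by (simp add: fourier_coeff_def)

lemma norm_fourier_coeff_le:
  assumes "\<And>\<zeta>. \<zeta> \<in> circle \<Longrightarrow> cmod (F \<zeta>) \<le> B"
  shows "cmod (fourier_coeff F n) \<le> B"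
  unfolding fourier_coeff_def
  by (rule norm_integral_circle_le) (simp add: norm_mult norm_powi_circle assms del: norm_power_int)

lemma norm_fourier_coeff_diff_le:
  assumes "continuous_on circle F" "continuous_on circle G"
    and "\<And>\<zeta>. \<zeta> \<in> circle \<Longrightarrow> cmod (F \<zeta> - G \<zeta>) \<le> B"
  shows "cmod (fourier_coeff F n - fourier_coeff G n) \<le> B"
  using norm_fourier_coeff_le[of "\<lambda>\<zeta>. F \<zeta> - G \<zeta>"] assms(3)
  by (simp add: fourier_coeff_diff[OF assms(1,2)])

text \<open>
  \<open>H\<close> is orthogonal to all trigonometric polynomials, one of which is uniformly close to
  \<open>cnj H\<close>. Hence the integral of \<open>(cmod H)\<^sup>2\<close> vanishes.
\<close>
lemma fourier_coeff_eq_0_imp_0: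
  assumes H: "continuous_on circle H" and 0: "\<And>n. fourier_coeff H n = 0" and \<zeta>: "\<zeta> \<in> circle"
  shows "H \<zeta> = 0"
proof -
  have tp: "(\<integral>\<zeta>. H \<zeta> * P \<zeta> \<partial>circle_lebesgue) = 0" if "trig_poly P" for P
    using that
  proof (induction rule: trig_poly.induct)
    case (monomial P c k)
    have "(\<integral>\<zeta>. H \<zeta> * P \<zeta> \<partial>circle_lebesgue) = (\<integral>\<zeta>. c * (H \<zeta> * \<zeta> powi (- (- k))) \<partial>circle_lebesgue)"
      by (intro Bochner_Integration.integral_cong refl) (simp add: monomial)
    then show ?case using 0[of "- k"] by (simp add: fourier_coeff_def)
  next
    case (add P Q R)
    have "(\<integral>\<zeta>. H \<zeta> * R \<zeta> \<partial>circle_lebesgue) = (\<integral>\<zeta>. H \<zeta> * P \<zeta> + H \<zeta> * Q \<zeta> \<partial>circle_lebesgue)"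
      by (intro Bochner_Integration.integral_cong refl) (simp add: add distrib_left)
    also have "\<dots> = (\<integral>\<zeta>. H \<zeta> * P \<zeta> \<partial>circle_lebesgue) + (\<integral>\<zeta>. H \<zeta> * Q \<zeta> \<partial>circle_lebesgue)"
      by (intro Bochner_Integration.integral_add integrable_circle_continuous continuous_intros
          H trig_poly_continuous add)
    finally show ?case by (simp add: add)
  qed
  obtain B where B0: "0 \<le> B" and B: "\<And>\<zeta>. \<zeta> \<in> circle \<Longrightarrow> cmod (H \<zeta>) \<le> B"
    using bounded_on_circle[OF H] by blast
  have Hc: "continuous_on circle (\<lambda>\<zeta>. cnj (H \<zeta>))" by (intro continuous_intros H)
  have "cmod (\<integral>\<zeta>. H \<zeta> * cnj (H \<zeta>) \<partial>circle_lebesgue) \<le> e" if e: "e > 0" for e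
  proof -
    have d: "e / (B + 1) > 0" using e B0 by simp
    obtain P where P: "trig_poly P" "\<And>\<zeta>. \<zeta> \<in> circle \<Longrightarrow> cmod (cnj (H \<zeta>) - P \<zeta>) < e / (B + 1)"
      using trig_poly_dense_complex[OF Hc d] by blast
    have "(\<integral>\<zeta>. H \<zeta> * cnj (H \<zeta>) \<partial>circle_lebesgue) =
        (\<integral>\<zeta>. H \<zeta> * cnj (H \<zeta>) \<partial>circle_lebesgue) - (\<integral>\<zeta>. H \<zeta> * P \<zeta> \<partial>circle_lebesgue)"
      by (simp add: tp[OF P(1)])
    also have "\<dots> = (\<integral>\<zeta>. H \<zeta> * cnj (H \<zeta>) - H \<zeta> * P \<zeta> \<partial>circle_lebesgue)"
      by (intro Bochner_Integration.integral_diff[symmetric] integrable_circle_continuous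
          continuous_intros H trig_poly_continuous P)
    also have "cmod \<dots> \<le> B * (e / (B + 1))"
    proof (rule norm_integral_circle_le)
      fix \<zeta> :: complex assume z: "\<zeta> \<in> circle"
      have "cmod (H \<zeta> * cnj (H \<zeta>) - H \<zeta> * P \<zeta>) = cmod (H \<zeta>) * cmod (cnj (H \<zeta>) - P \<zeta>)"
        by (simp add: norm_mult[symmetric] right_diff_distrib)
      also have "\<dots> \<le> B * (e / (B + 1))"
        using B[OF z] P(2)[OF z] B0 by (intro mult_mono) auto
      finally show "cmod (H \<zeta> * cnj (H \<zeta>) - H \<zeta> * P \<zeta>) \<le> B * (e / (B + 1))" .
    qed
    also have "\<dots> \<le> e" using e B0 by (simp add: field_simps)
    finally show ?thesis .
  qed
  then have "cmod (\<integral>\<zeta>. H \<zeta> * cnj (H \<zeta>) \<partial>circle_lebesgue) \<le> 0"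
    by (rule field_le_epsilon[of _ 0, unfolded add_0_left])
  then have "(\<integral>\<zeta>. complex_of_real ((cmod (H \<zeta>))\<^sup>2) \<partial>circle_lebesgue) = 0"
    by (simp only: complex_norm_square norm_le_zero_iff)
  then have "(\<integral>\<zeta>. (cmod (H \<zeta>))\<^sup>2 \<partial>circle_lebesgue) = 0"
    by (simp only: integral_complex_of_real of_real_eq_0_iff)
  moreover have "continuous_on circle (\<lambda>\<zeta>. (cmod (H \<zeta>))\<^sup>2)" by (intro continuous_intros H)
  ultimately have int: "((\<lambda>t. (cmod (H (cis (2 * pi * t))))\<^sup>2) has_integral 0) (cbox 0 1)"
    using has_integral_circle[of "\<lambda>\<zeta>. (cmod (H \<zeta>))\<^sup>2"] by simp
  obtain t where t: "t \<in> {0..1}" "\<zeta> = cis (2 * pi * t)" using circle_parametrization[OF \<zeta>] by blast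
  have "(cmod (H (cis (2 * pi * t))))\<^sup>2 = 0"
  proof (rule has_integral_0_cbox_imp_0[OF _ _ int])
    have "continuous_on (cbox 0 1) (\<lambda>t. H (cis (2 * pi * t)))"
      by (rule continuous_on_compose2[OF H]) (auto intro!: continuous_intros)
    then show "continuous_on (cbox 0 1) (\<lambda>t. (cmod (H (cis (2 * pi * t))))\<^sup>2)" by (intro continuous_intros)
  qed (use t in auto)
  then show ?thesis by (simp add: t)
qed

section \<open>Absolutely convergent Fourier series\<close>

text \<open>
  A bound on the norm of the Wiener algebra of absolutely convergent Fourier series. Bounding the
  finite partial sums keeps summability out of the definition.
\<close>
definition wiener_bound :: "real \<Rightarrow> (complex \<Rightarrow> complex) \<Rightarrow> bool" where
  "wiener_bound K F \<longleftrightarrow> continuous_on circle F \<and>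
     (\<forall>S. finite S \<longrightarrow> (\<Sum>n\<in>S. cmod (fourier_coeff F n)) \<le> K)"

lemma wiener_boundD:
  assumes "wiener_bound K F"
  shows "continuous_on circle F" "\<And>S. finite S \<Longrightarrow> (\<Sum>n\<in>S. cmod (fourier_coeff F n)) \<le> K"
  using assms by (auto simp: wiener_bound_def)

lemma wiener_bound_nonneg: "wiener_bound K F \<Longrightarrow> 0 \<le> K"
  using wiener_boundD(2)[of K F "{}"] by simp

text \<open>
  The Fourier series converges uniformly by the Weierstrass test, and its sum has the same
  coefficients as \<open>F\<close>, so it equals \<open>F\<close>. Only approximation by finite sums, over index sets as large
  as desired, is recorded: integrals can then be exchanged with finite sums.
\<close>
lemma fourier_inversion:
  assumes F: "wiener_bound K F" and \<delta>: "0 < \<delta>" and X: "finite X"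
  shows "\<exists>S. finite S \<and> X \<subseteq> S \<and>
    (\<forall>\<zeta>\<in>circle. cmod (F \<zeta> - (\<Sum>k\<in>S. fourier_coeff F k * \<zeta> powi k)) \<le> \<delta>)"
proof -
  let ?P = "\<lambda>S \<zeta>. \<Sum>k\<in>S. fourier_coeff F k * \<zeta> powi k"
  define T where "T \<zeta> = (\<Sum>\<^sub>\<infinity>k. fourier_coeff F k * \<zeta> powi k)" for \<zeta>
  have P_cont: "continuous_on circle (?P S)" for S
    by (intro continuous_intros) (auto simp: circle_nonzero)
  have "(\<lambda>k. cmod (fourier_coeff F k)) summable_on UNIV"
    by (rule nonneg_bdd_above_summable_on)
      (auto intro!: bdd_aboveI2[where M = K] wiener_boundD(2)[OF F])
  then have lim: "uniform_limit circle ?P T (finite_subsets_at_top UNIV)"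
    unfolding T_def
    by (intro Weierstrass_m_test_general) (auto simp: norm_mult norm_power_int)
  have T_cont: "continuous_on circle T"
    by (rule uniform_limit_theorem[OF _ lim]) (auto intro!: always_eventually P_cont)
  have near: "\<exists>S. finite S \<and> X \<subseteq> S \<and> (\<forall>\<zeta>\<in>circle. cmod (?P S \<zeta> - T \<zeta>) < e)"
    if e: "e > 0" and X: "finite X" for e X
  proof -
    from uniform_limitD[OF lim e] obtain Y where Y: "finite Y"
      "\<And>S. finite S \<Longrightarrow> Y \<subseteq> S \<Longrightarrow> \<forall>\<zeta>\<in>circle. dist (?P S \<zeta>) (T \<zeta>) < e"
      unfolding eventually_finite_subsets_at_top by auto
    show ?thesis
      using Y(2)[of "X \<union> Y"] Y(1) X by (intro exI[of _ "X \<union> Y"]) (auto simp: dist_norm)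
  qed
  have "fourier_coeff T n = fourier_coeff F n" for n
  proof -
    have "cmod (fourier_coeff F n - fourier_coeff T n) \<le> e" if e: "e > 0" for e
    proof -
      obtain S where S: "finite S" "{n} \<subseteq> S" "\<forall>\<zeta>\<in>circle. cmod (?P S \<zeta> - T \<zeta>) < e"
        using near[OF e, of "{n}"] by auto
      have "fourier_coeff (?P S) n = (\<Sum>k\<in>S. fourier_coeff (\<lambda>\<zeta>. fourier_coeff F k * \<zeta> powi k) n)"
        by (intro fourier_coeff_sum S continuous_intros) (auto simp: circle_nonzero)
      also have "\<dots> = (\<Sum>k\<in>S. if k = n then fourier_coeff F n else 0)"
        by (intro sum.cong refl) (auto simp: fourier_coeff_cmult fourier_coeff_powi)
      also have "\<dots> = fourier_coeff F n" using S by simp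
      finally have "fourier_coeff (?P S) n = fourier_coeff F n" .
      moreover have "cmod (fourier_coeff (?P S) n - fourier_coeff T n) \<le> e"
        by (rule norm_fourier_coeff_diff_le[OF P_cont T_cont]) (use S(3) less_imp_le in blast)
      ultimately show ?thesis by simp
    qed
    then have "cmod (fourier_coeff F n - fourier_coeff T n) \<le> 0"
      by (rule field_le_epsilon[of _ 0, unfolded add_0_left])
    then show ?thesis by simp
  qed
  then have eq: "F \<zeta> = T \<zeta>" if "\<zeta> \<in> circle" for \<zeta>
    using fourier_coeff_eq_0_imp_0[of "\<lambda>\<zeta>. F \<zeta> - T \<zeta>" \<zeta>] that
      fourier_coeff_diff[OF wiener_boundD(1)[OF F] T_cont] wiener_boundD(1)[OF F] T_cont
    by (simp add: continuous_on_diff)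
  from near[OF \<delta> X] obtain S where S: "finite S" "X \<subseteq> S" "\<forall>\<zeta>\<in>circle. cmod (?P S \<zeta> - T \<zeta>) < \<delta>"
    by blast
  show ?thesis
  proof (intro exI[of _ S] conjI ballI S(1,2))
    fix \<zeta> :: complex assume z: "\<zeta> \<in> circle"
    then have "cmod (?P S \<zeta> - F \<zeta>) < \<delta>" using S(3) eq by simp
    then show "cmod (F \<zeta> - ?P S \<zeta>) \<le> \<delta>" by (simp add: norm_minus_commute)
  qed
qed

lemma wiener_bound_cmult:
  assumes "wiener_bound K F"
  shows "wiener_bound (cmod c * K) (\<lambda>\<zeta>. c * F \<zeta>)"
  unfolding wiener_bound_def
proof (intro conjI allI impI)
  show "continuous_on circle (\<lambda>\<zeta>. c * F \<zeta>)" by (intro continuous_intros wiener_boundD(1)[OF assms])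
  fix S :: "int set" assume "finite S"
  then show "(\<Sum>n\<in>S. cmod (fourier_coeff (\<lambda>\<zeta>. c * F \<zeta>) n)) \<le> cmod c * K"
    by (simp add: fourier_coeff_cmult norm_mult sum_distrib_left[symmetric] mult_left_mono wiener_boundD(2)[OF assms])
qed

lemma wiener_bound_diff:
  assumes F: "wiener_bound K F" and G: "wiener_bound L G"
  shows "wiener_bound (K + L) (\<lambda>\<zeta>. F \<zeta> - G \<zeta>)"
  unfolding wiener_bound_def
proof (intro conjI allI impI)
  show "continuous_on circle (\<lambda>\<zeta>. F \<zeta> - G \<zeta>)" by (intro continuous_intros wiener_boundD(1)[OF F] wiener_boundD(1)[OF G])
  fix S :: "int set" assume S: "finite S"
  have "(\<Sum>n\<in>S. cmod (fourier_coeff (\<lambda>\<zeta>. F \<zeta> - G \<zeta>) n)) \<le>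
      (\<Sum>n\<in>S. cmod (fourier_coeff F n) + cmod (fourier_coeff G n))"
    unfolding fourier_coeff_diff[OF wiener_boundD(1)[OF F] wiener_boundD(1)[OF G]]
    by (intro sum_mono norm_triangle_ineq4)
  also have "\<dots> \<le> K + L"
    unfolding sum.distrib by (intro add_mono wiener_boundD(2)[OF F S] wiener_boundD(2)[OF G S])
  finally show "(\<Sum>n\<in>S. cmod (fourier_coeff (\<lambda>\<zeta>. F \<zeta> - G \<zeta>) n)) \<le> K + L" .
qed

lemma wiener_bound_1: "wiener_bound 1 (\<lambda>_. 1)"
  unfolding wiener_bound_def
proof (intro conjI allI impI)
  fix S :: "int set" assume S: "finite S"
  have "(\<Sum>n\<in>S. cmod (fourier_coeff (\<lambda>_. 1) n)) = (\<Sum>n\<in>S. if n = 0 then 1 else 0)"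
    using fourier_coeff_powi[of 0] by (intro sum.cong refl) simp
  also have "\<dots> \<le> 1" using S by simp
  finally show "(\<Sum>n\<in>S. cmod (fourier_coeff (\<lambda>_. 1) n)) \<le> 1" .
qed simp

lemma power_in_circle: "\<zeta> \<in> circle \<Longrightarrow> \<zeta> ^ N \<in> circle"
  by (simp add: norm_power)

lemma continuous_on_dilate:
  "continuous_on circle G \<Longrightarrow> continuous_on circle (\<lambda>\<zeta>. G (\<zeta> ^ N))"
  by (rule continuous_on_compose2[of circle G]) (auto intro!: continuous_intros simp: norm_power)

lemma power_powi: "((\<zeta>::complex) ^ N) powi k = \<zeta> powi (int N * k)"
  by (simp add: power_int_mult)

text \<open>
  Expanding \<open>G\<close> in its Fourier series writes the coefficient of the product at \<open>n\<close> as the sum over \<open>k\<close>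
  of \<open>fourier_coeff G k * fourier_coeff F (n - N * k)\<close>, and Young's inequality for
  \<open>\<ell>\<^sup>1\<close> gives the product of the norms, uniformly in the dilation factor \<open>N\<close>.
\<close>
lemma wiener_bound_mult_dilate:
  assumes F: "wiener_bound K F" and G: "wiener_bound L G"
  shows "wiener_bound (K * L) (\<lambda>\<zeta>. F \<zeta> * G (\<zeta> ^ N))"
  unfolding wiener_bound_def
proof (intro conjI allI impI)
  note Fc = wiener_boundD(1)[OF F]
  show FG: "continuous_on circle (\<lambda>\<zeta>. F \<zeta> * G (\<zeta> ^ N))"
    by (intro continuous_intros Fc continuous_on_dilate wiener_boundD(1)[OF G])
  fix S :: "int set" assume S: "finite S"
  obtain B where B0: "0 \<le> B" and B: "\<And>\<zeta>. \<zeta> \<in> circle \<Longrightarrow> cmod (F \<zeta>) \<le> B"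
    using bounded_on_circle[OF Fc] by blast
  have "(\<Sum>n\<in>S. cmod (fourier_coeff (\<lambda>\<zeta>. F \<zeta> * G (\<zeta> ^ N)) n)) \<le> K * L + e" if e: "e > 0" for e
  proof -
    define \<delta> where "\<delta> = e / ((real (card S) + 1) * (B + 1))"
    have \<delta>: "\<delta> > 0" using e B0 by (simp add: \<delta>_def)
    obtain T where T: "finite T"
      "\<forall>\<zeta>\<in>circle. cmod (G \<zeta> - (\<Sum>k\<in>T. fourier_coeff G k * \<zeta> powi k)) \<le> \<delta>"
      using fourier_inversion[OF G \<delta> finite.emptyI] by blast
    define P where "P \<zeta> = (\<Sum>k\<in>T. fourier_coeff G k * (F \<zeta> * \<zeta> powi (int N * k)))" for \<zeta>
    have P_cont: "continuous_on circle P"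
      unfolding P_def by (intro continuous_intros continuous_on_mult_powi Fc)
    have P_coeff: "fourier_coeff P n = (\<Sum>k\<in>T. fourier_coeff G k * fourier_coeff F (n - int N * k))" for n
    proof -
      have "fourier_coeff P n = (\<Sum>k\<in>T. fourier_coeff (\<lambda>\<zeta>. fourier_coeff G k * (F \<zeta> * \<zeta> powi (int N * k))) n)"
        unfolding P_def by (intro fourier_coeff_sum T continuous_intros continuous_on_mult_powi Fc)
      then show ?thesis by (simp add: fourier_coeff_cmult fourier_coeff_mult_powi)
    qed
    have diff: "cmod (fourier_coeff (\<lambda>\<zeta>. F \<zeta> * G (\<zeta> ^ N)) n - fourier_coeff P n) \<le> B * \<delta>" for n
    proof (rule norm_fourier_coeff_diff_le[OF FG P_cont])
      fix \<zeta> :: complex assume z: "\<zeta> \<in> circle"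
      have "P \<zeta> = F \<zeta> * (\<Sum>k\<in>T. fourier_coeff G k * (\<zeta> ^ N) powi k)"
        by (simp add: P_def sum_distrib_left power_powi mult_ac)
      then have "cmod (F \<zeta> * G (\<zeta> ^ N) - P \<zeta>) =
          cmod (F \<zeta>) * cmod (G (\<zeta> ^ N) - (\<Sum>k\<in>T. fourier_coeff G k * (\<zeta> ^ N) powi k))"
        by (simp add: norm_mult[symmetric] right_diff_distrib)
      also have "\<dots> \<le> B * \<delta>"
        using B0 by (intro mult_mono B T(2)[rule_format] z power_in_circle) auto
      finally show "cmod (F \<zeta> * G (\<zeta> ^ N) - P \<zeta>) \<le> B * \<delta>" .
    qed
    have "(\<Sum>n\<in>S. cmod (fourier_coeff P n)) \<le> K * L"
    proof -
      have "(\<Sum>n\<in>S. cmod (fourier_coeff P n)) \<le>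
          (\<Sum>n\<in>S. \<Sum>k\<in>T. cmod (fourier_coeff G k) * cmod (fourier_coeff F (n - int N * k)))"
        unfolding P_coeff by (intro sum_mono order_trans[OF norm_sum]) (simp add: norm_mult)
      also have "\<dots> = (\<Sum>k\<in>T. cmod (fourier_coeff G k) * (\<Sum>n\<in>S. cmod (fourier_coeff F (n - int N * k))))"
        unfolding sum_distrib_left by (rule sum.swap)
      also have "\<dots> \<le> (\<Sum>k\<in>T. cmod (fourier_coeff G k) * K)"
      proof (intro sum_mono mult_left_mono)
        fix k
        have "(\<Sum>n\<in>S. cmod (fourier_coeff F (n - int N * k))) =
            (\<Sum>m\<in>(\<lambda>n. n - int N * k) ` S. cmod (fourier_coeff F m))"
          by (subst sum.reindex) (auto simp: inj_on_def)
        also have "\<dots> \<le> K" using S by (intro wiener_boundD(2)[OF F]) simp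
        finally show "(\<Sum>n\<in>S. cmod (fourier_coeff F (n - int N * k))) \<le> K" .
      qed simp
      also have "\<dots> \<le> L * K"
        unfolding sum_distrib_right[symmetric]
        by (intro mult_right_mono wiener_boundD(2)[OF G T(1)] wiener_bound_nonneg[OF F])
      finally show ?thesis by (simp add: mult.commute)
    qed
    moreover have "(\<Sum>n\<in>S. cmod (fourier_coeff (\<lambda>\<zeta>. F \<zeta> * G (\<zeta> ^ N)) n)) \<le>
        (\<Sum>n\<in>S. cmod (fourier_coeff P n) + B * \<delta>)"
    proof (rule sum_mono)
      fix n
      show "cmod (fourier_coeff (\<lambda>\<zeta>. F \<zeta> * G (\<zeta> ^ N)) n) \<le> cmod (fourier_coeff P n) + B * \<delta>"
        using norm_triangle_sub[of "fourier_coeff (\<lambda>\<zeta>. F \<zeta> * G (\<zeta> ^ N)) n" "fourier_coeff P n"] diff[of n]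
        by linarith
    qed
    moreover have "real (card S) * (B * \<delta>) \<le> e"
    proof -
      have "real (card S) * (B * \<delta>) = (real (card S) * B) * \<delta>" by simp
      also have "\<dots> \<le> ((real (card S) + 1) * (B + 1)) * \<delta>"
        using B0 \<delta> by (intro mult_right_mono mult_mono) auto
      also have "\<dots> = e" using B0 by (simp add: \<delta>_def)
      finally show ?thesis .
    qed
    ultimately show ?thesis by (simp add: sum.distrib)
  qed
  then show "(\<Sum>n\<in>S. cmod (fourier_coeff (\<lambda>\<zeta>. F \<zeta> * G (\<zeta> ^ N)) n)) \<le> K * L"
    by (rule field_le_epsilon)
qed

text \<open>
  Every monomial \<open>\<zeta> powi (N * k)\<close> with \<open>k \<noteq> 0\<close> has mean \<open>0\<close>, so the dilation does not change the mean.
\<close>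
lemma fourier_coeff_0_dilate:
  assumes G: "wiener_bound L G" and N: "N \<ge> 1"
  shows "fourier_coeff (\<lambda>\<zeta>. G (\<zeta> ^ N)) 0 = fourier_coeff G 0"
proof -
  have "cmod (fourier_coeff (\<lambda>\<zeta>. G (\<zeta> ^ N)) 0 - fourier_coeff G 0) \<le> e" if e: "e > 0" for e
  proof -
    have e2: "e / 2 > 0" using e by simp
    obtain T where T: "finite T"
      "\<forall>\<zeta>\<in>circle. cmod (G \<zeta> - (\<Sum>k\<in>T. fourier_coeff G k * \<zeta> powi k)) \<le> e / 2"
      using fourier_inversion[OF G e2 finite.emptyI] by blast
    define P where "P N \<zeta> = (\<Sum>k\<in>T. fourier_coeff G k * (\<zeta> ^ N) powi k)" for N :: nat and \<zeta>
    have c: "continuous_on circle (\<lambda>\<zeta>. fourier_coeff G k * (\<zeta> ^ N) powi k)" for k N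
      by (intro continuous_intros) (auto simp: circle_nonzero)
    have P_coeff: "fourier_coeff (P N) 0 = (\<Sum>k\<in>T. if k = 0 then fourier_coeff G k else 0)"
      if "N \<ge> 1" for N
    proof -
      have "fourier_coeff (P N) 0 = (\<Sum>k\<in>T. fourier_coeff (\<lambda>\<zeta>. fourier_coeff G k * (\<zeta> ^ N) powi k) 0)"
        unfolding P_def by (intro fourier_coeff_sum T c)
      also have "\<dots> = (\<Sum>k\<in>T. if k = 0 then fourier_coeff G k else 0)"
        using that by (intro sum.cong refl) (simp add: power_powi fourier_coeff_cmult fourier_coeff_powi)
      finally show ?thesis .
    qed
    have P_cont: "continuous_on circle (P N)" for N
      unfolding P_def by (intro continuous_on_sum c)
    have "cmod (fourier_coeff (\<lambda>\<zeta>. G (\<zeta> ^ N)) 0 - fourier_coeff (P N) 0) \<le> e / 2" for N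
      by (rule norm_fourier_coeff_diff_le[OF continuous_on_dilate[OF wiener_boundD(1)[OF G]] P_cont])
        (unfold P_def, rule T(2)[rule_format], rule power_in_circle)
    from this[of N] this[of 1] have "cmod (fourier_coeff (\<lambda>\<zeta>. G (\<zeta> ^ N)) 0 - fourier_coeff (P N) 0) \<le> e / 2"
      "cmod (fourier_coeff G 0 - fourier_coeff (P N) 0) \<le> e / 2"
      using P_coeff[OF N] P_coeff[of 1] by simp_all
    then show ?thesis
      using norm_triangle_ineq4[of "fourier_coeff (\<lambda>\<zeta>. G (\<zeta> ^ N)) 0 - fourier_coeff (P N) 0"
          "fourier_coeff G 0 - fourier_coeff (P N) 0"] by simp
  qed
  then have "cmod (fourier_coeff (\<lambda>\<zeta>. G (\<zeta> ^ N)) 0 - fourier_coeff G 0) \<le> 0"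
    by (rule field_le_epsilon[of _ 0, unfolded add_0_left])
  then show ?thesis by simp
qed

section \<open>Tents and bumps\<close>

text \<open>
  On the circle, \<open>arccos (Re \<zeta>)\<close> is the distance along the circle from \<open>\<zeta>\<close> to \<open>1\<close>. In the parameter \<open>t\<close>
  this is the triangle function of height \<open>1\<close> supported on \<open>\<bar>t\<bar> \<le> h\<close>.
\<close>
definition tent :: "real \<Rightarrow> complex \<Rightarrow> real" where
  "tent h \<zeta> = max 0 (1 - arccos (Re \<zeta>) / (2 * pi * h))"

lemma Re_circle_bounds: "\<zeta> \<in> circle \<Longrightarrow> Re \<zeta> \<in> {-1..1}"
  using abs_Re_le_cmod[of \<zeta>] by auto

lemma continuous_on_tent: "continuous_on circle (tent h)"
proof -
  have "continuous_on circle (\<lambda>\<zeta>. arccos (Re \<zeta>))"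
  proof (rule continuous_on_compose2[OF continuous_on_arccos'])
    show "continuous_on circle Re" by (intro continuous_intros)
    show "Re ` circle \<subseteq> {-1..1}" using Re_circle_bounds by blast
  qed
  then have "continuous_on circle (\<lambda>\<zeta>. max 0 (1 - (1 / (2 * pi * h)) * arccos (Re \<zeta>)))"
    by (intro continuous_on_max continuous_on_diff continuous_on_mult continuous_on_const)
  then show ?thesis by (simp add: tent_def[abs_def])
qed

lemma has_integral_cong_Icc:
  fixes f g :: "real \<Rightarrow> complex"
  assumes "(f has_integral I) {a..b}" "\<And>t. t \<in> {a..b} \<Longrightarrow> g t = f t"
  shows "(g has_integral I) {a..b}"
  using has_integral_eq[of "{a..b}" f g I] assms by auto

text \<open>
  What matters is that the coefficients are non-negative and \<open>O(1 / k\<^sup>2)\<close>.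
\<close>
lemma fourier_coeff_tent:
  assumes h: "0 < h" "h \<le> 1 / 2"
  shows "fourier_coeff (\<lambda>\<zeta>. complex_of_real (tent h \<zeta>)) k =
    complex_of_real (if k = 0 then h else (1 - cos (2 * pi * of_int k * h)) / (2 * pi\<^sup>2 * (of_int k)\<^sup>2 * h))"
proof -
  define a where "a = 2 * pi * of_int k"
  define f where "f t = complex_of_real (tent h (cis (2 * pi * t))) * cis (2 * pi * t) powi (- k)" for t
  have cis_pow: "cis (2 * pi * t) powi (- k) = cis (- (a * t))" for t
    by (simp add: a_def cis_power_int mult_ac)
  have F: "continuous_on circle (\<lambda>\<zeta>. complex_of_real (tent h \<zeta>) * \<zeta> powi (- k))"
    by (intro continuous_on_mult_powi continuous_intros continuous_on_tent)
  have whole: "(f has_integral fourier_coeff (\<lambda>\<zeta>. complex_of_real (tent h \<zeta>)) k) {0..1}"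
    using has_integral_circle[OF F] by (simp add: f_def[abs_def] fourier_coeff_def)
  have tent_left: "tent h (cis (2 * pi * t)) = max 0 (1 - t / h)" if "0 \<le> t" "t \<le> 1 / 2" for t
    using that h by (simp add: tent_def arccos_cos)
  have tent_right: "tent h (cis (2 * pi * t)) = max 0 (1 - (1 - t) / h)" if "1 / 2 \<le> t" "t \<le> 1" for t
  proof -
    have "cos (2 * pi * t) = cos (2 * pi * (1 - t))"
      using cos_periodic[of "- (2 * pi * t)"] by (simp add: algebra_simps)
    then have "tent h (cis (2 * pi * t)) = tent h (cis (2 * pi * (1 - t)))"
      by (simp add: tent_def)
    then show ?thesis using tent_left[of "1 - t"] that by simp
  qed
  \<comment> \<open>The tent occupies both ends of the parameter interval, because \<open>1\<close> is \<open>cis\<close> of both endpoints.\<close>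
  have mid: "(f has_integral 0) {h..1 - h}"
  proof (rule has_integral_cong_Icc)
    show "((\<lambda>_. 0) has_integral (0::complex)) {h..1 - h}" by simp
    fix t assume t: "t \<in> {h..1 - h}"
    have "tent h (cis (2 * pi * t)) = 0"
      using tent_left[of t] tent_right[of t] t h by (cases "t \<le> 1 / 2") (auto simp: field_simps)
    then show "f t = 0" by (simp add: f_def)
  qed
  have f_left: "f t = of_real (1 + (- 1 / h) * t) * cis (- (a * t))" if "t \<in> {0..h}" for t
    using tent_left[of t] that h by (simp add: f_def cis_pow max_absorb2)
  have f_right: "f t = of_real ((1 - 1 / h) + 1 / h * t) * cis (- (a * t))" if "t \<in> {1 - h..1}" for t
  proof -
    have "1 - (1 - t) / h = (1 - 1 / h) + 1 / h * t" "1 - (1 - t) / h \<ge> 0"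
      using that h by (simp_all add: diff_divide_distrib)  (simp add: field_simps)
    moreover have "tent h (cis (2 * pi * t)) = max 0 (1 - (1 - t) / h)"
      using tent_right[of t] that h by simp
    ultimately have "tent h (cis (2 * pi * t)) = (1 - 1 / h) + 1 / h * t" by (simp only: max_absorb2)
    then show ?thesis unfolding f_def cis_pow by simp
  qed
  have combine: "fourier_coeff (\<lambda>\<zeta>. complex_of_real (tent h \<zeta>)) k = I + J"
    if I: "(f has_integral I) {0..h}" and J: "(f has_integral J) {1 - h..1}" for I J
  proof -
    have "(f has_integral (I + 0)) {0..1 - h}"
      by (rule has_integral_combine[OF _ _ I mid]) (use h in auto)
    then have "(f has_integral (I + 0 + J)) {0..1}"
      by (rule has_integral_combine[rotated 2, OF _ J]) (use h in auto)
    then show ?thesis using has_integral_unique[OF whole] by simp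
  qed
  show ?thesis
  proof (cases "k = 0")
    case True
    then have a: "a = 0" by (simp add: a_def)
    have poly: "((\<lambda>t. complex_of_real (\<alpha> + \<beta> * t)) has_integral
        (complex_of_real (\<alpha> * v + \<beta> * v\<^sup>2 / 2) - complex_of_real (\<alpha> * u + \<beta> * u\<^sup>2 / 2))) {u..v}"
      if "u \<le> v" for \<alpha> \<beta> u v :: real
    proof (rule fundamental_theorem_of_calculus[OF that])
      fix t
      have "((\<lambda>t. \<alpha> * t + \<beta> * t\<^sup>2 / 2) has_real_derivative (\<alpha> + \<beta> * t)) (at t within {u..v})"
        by (auto intro!: derivative_eq_intros)
      then show "((\<lambda>t. complex_of_real (\<alpha> * t + \<beta> * t\<^sup>2 / 2)) has_vector_derivative complex_of_real (\<alpha> + \<beta> * t)) (at t within {u..v})"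
        by (rule has_vector_derivative_of_real)
    qed
    have "fourier_coeff (\<lambda>\<zeta>. complex_of_real (tent h \<zeta>)) k = complex_of_real (h / 2) + complex_of_real (h / 2)"
    proof (rule combine)
      have "(f has_integral (complex_of_real (1 * h + (- 1 / h) * h\<^sup>2 / 2) - complex_of_real (1 * 0 + (- 1 / h) * 0\<^sup>2 / 2))) {0..h}"
        by (rule has_integral_cong_Icc[OF poly]) (use h f_left a in auto)
      then show "(f has_integral complex_of_real (h / 2)) {0..h}"
        using h by (simp add: power2_eq_square)
      have "(f has_integral (complex_of_real ((1 - 1 / h) * 1 + 1 / h * 1\<^sup>2 / 2) -
          complex_of_real ((1 - 1 / h) * (1 - h) + 1 / h * (1 - h)\<^sup>2 / 2))) {1 - h..1}"
        by (rule has_integral_cong_Icc[OF poly]) (use h f_right a in auto)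
      moreover have "((1 - 1 / h) * 1 + 1 / h * 1\<^sup>2 / 2) - ((1 - 1 / h) * (1 - h) + 1 / h * (1 - h)\<^sup>2 / 2) = h / 2"
        using h by (simp add: field_simps power2_eq_square)
      ultimately show "(f has_integral complex_of_real (h / 2)) {1 - h..1}"
        by (simp only: of_real_diff[symmetric])
    qed
    then show ?thesis using True by (simp flip: of_real_add)
  next
    case False
    then have a: "a \<noteq> 0" by (simp add: a_def)
    define G where "G \<alpha> \<beta> t = cis (- (a * t)) * (\<i> * of_real (\<alpha> + \<beta> * t) / of_real a + of_real \<beta> / of_real a ^ 2)" for \<alpha> \<beta> t
    have "(f has_integral (G 1 (- 1 / h) h - G 1 (- 1 / h) 0)) {0..h}"
      unfolding G_def by (rule has_integral_cong_Icc[OF has_integral_affine_cis[OF a]]) (use h f_left in auto)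
    moreover have "(f has_integral (G (1 - 1 / h) (1 / h) 1 - G (1 - 1 / h) (1 / h) (1 - h))) {1 - h..1}"
      unfolding G_def by (rule has_integral_cong_Icc[OF has_integral_affine_cis[OF a]]) (use h f_right in auto)
    ultimately have sumG: "fourier_coeff (\<lambda>\<zeta>. complex_of_real (tent h \<zeta>)) k =
        (G 1 (- 1 / h) h - G 1 (- 1 / h) 0) + (G (1 - 1 / h) (1 / h) 1 - G (1 - 1 / h) (1 / h) (1 - h))"
      by (rule combine)
    have cis_a: "cis (- a) = 1"
      using cis_2pi_int[of "- k"] by (simp add: a_def)
    have cis_1h: "cis (- (a * (1 - h))) = cis (a * h)"
    proof -
      have "cis (- (a * (1 - h))) = cis (- a) * cis (a * h)" by (simp add: cis_mult algebra_simps)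
      then show ?thesis by (simp add: cis_a)
    qed
    have e: "1 + (- 1 / h) * h = 0" "1 - 1 / h + 1 / h * (1 - h) = 0" using h by (simp_all add: field_simps)
    have G: "G 1 (- 1 / h) h = - cis (- (a * h)) / (of_real h * of_real a ^ 2)"
      "G 1 (- 1 / h) 0 = \<i> / of_real a - 1 / (of_real h * of_real a ^ 2)"
      "G (1 - 1 / h) (1 / h) 1 = \<i> / of_real a + 1 / (of_real h * of_real a ^ 2)"
      "G (1 - 1 / h) (1 / h) (1 - h) = cis (a * h) / (of_real h * of_real a ^ 2)"
      unfolding G_def e cis_1h by (simp_all add: cis_a)
    have "fourier_coeff (\<lambda>\<zeta>. complex_of_real (tent h \<zeta>)) k =
        (2 - (cis (a * h) + cis (- (a * h)))) / (of_real h * of_real a ^ 2)"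
      unfolding sumG G by (simp add: add_divide_distrib diff_divide_distrib)
    also have "cis (a * h) + cis (- (a * h)) = of_real (2 * cos (a * h))"
      by (simp add: complex_eq_iff)
    also have "(2 - complex_of_real (2 * cos (a * h))) / (of_real h * of_real a ^ 2) =
        complex_of_real ((2 - 2 * cos (a * h)) / (h * a\<^sup>2))" by simp
    also have "(2 - 2 * cos (a * h)) / (h * a\<^sup>2) =
        (1 - cos (2 * pi * of_int k * h)) / (2 * pi\<^sup>2 * (of_int k)\<^sup>2 * h)"
      using False h by (simp add: a_def field_simps power2_eq_square)
    finally show ?thesis using False by simp
  qed
qed

lemma sum_inverse_squares_int_le:
  assumes S: "finite S" "0 \<notin> S"
  shows "(\<Sum>k\<in>S. 1 / (of_int k)\<^sup>2) \<le> 2 * (\<Sum>n. 1 / (real (Suc n))\<^sup>2)"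
proof -
  have sm: "summable (\<lambda>n. 1 / (real (Suc n))\<^sup>2)"
    using inverse_squares_sums by (simp add: sums_iff)
  have part: "(\<Sum>k\<in>T. 1 / (of_int k)\<^sup>2) \<le> (\<Sum>n. 1 / (real (Suc n))\<^sup>2)"
    if T: "finite T" "inj_on (\<lambda>k. nat \<bar>k\<bar> - 1) T" "0 \<notin> T" for T :: "int set"
  proof -
    have "(\<Sum>k\<in>T. 1 / (of_int k)\<^sup>2) = (\<Sum>k\<in>T. 1 / (real (Suc (nat \<bar>k\<bar> - 1)))\<^sup>2)"
    proof (intro sum.cong refl)
      fix k assume "k \<in> T"
      then have "k \<noteq> 0" using T by auto
      then have "real (Suc (nat \<bar>k\<bar> - 1)) = \<bar>of_int k\<bar>" by simp
      then show "1 / (of_int k)\<^sup>2 = 1 / (real (Suc (nat \<bar>k\<bar> - 1)))\<^sup>2" by (simp only: power2_abs)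
    qed
    also have "\<dots> = (\<Sum>n\<in>(\<lambda>k. nat \<bar>k\<bar> - 1) ` T. 1 / (real (Suc n))\<^sup>2)"
      by (subst sum.reindex[OF T(2)]) simp
    also have "\<dots> \<le> (\<Sum>n. 1 / (real (Suc n))\<^sup>2)"
      using T by (intro sum_le_suminf sm) auto
    finally show ?thesis .
  qed
  have "(\<Sum>k\<in>S. 1 / (of_int k)\<^sup>2) = (\<Sum>k\<in>S \<inter> {0<..}. 1 / (of_int k)\<^sup>2) + (\<Sum>k\<in>S \<inter> {..<0}. 1 / (of_int k :: real)\<^sup>2)"
  proof (subst sum.union_disjoint[symmetric])
    have "S = S \<inter> {0<..} \<union> S \<inter> {..<0}"
      using S(2) by (auto simp: not_less order_le_less)
    then show "(\<Sum>k\<in>S. 1 / (of_int k)\<^sup>2) = (\<Sum>k\<in>S \<inter> {0<..} \<union> S \<inter> {..<0}. 1 / (of_int k :: real)\<^sup>2)"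
      by simp
  qed (use S in auto)
  also have "\<dots> \<le> (\<Sum>n. 1 / (real (Suc n))\<^sup>2) + (\<Sum>n. 1 / (real (Suc n))\<^sup>2)"
    using S by (intro add_mono part) (auto simp: inj_on_def)
  finally show ?thesis by simp
qed

text \<open>
  As the coefficients are non-negative, they sum up to the value at \<open>1\<close>, which is \<open>1\<close> for every \<open>h\<close>.
  The decay of the coefficients first gives a bound that depends on \<open>h\<close>, which is enough for
  Fourier inversion at \<open>1\<close>.
\<close>
lemma wiener_bound_tent:
  assumes h: "0 < h" "h \<le> 1 / 2"
  shows "wiener_bound 1 (\<lambda>\<zeta>. complex_of_real (tent h \<zeta>))"
proof -
  define c where "c k = (if k = 0 then h else (1 - cos (2 * pi * of_int k * h)) / (2 * pi\<^sup>2 * (of_int k)\<^sup>2 * h))" for k :: int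
  have coeff: "fourier_coeff (\<lambda>\<zeta>. complex_of_real (tent h \<zeta>)) k = complex_of_real (c k)" for k
    using fourier_coeff_tent[OF h] by (simp add: c_def)
  have c0: "c k \<ge> 0" for k using h by (simp add: c_def)
  have cont: "continuous_on circle (\<lambda>\<zeta>. complex_of_real (tent h \<zeta>))"
    by (intro continuous_intros continuous_on_tent)
  define Z where "Z = (\<Sum>n. 1 / (real (Suc n))\<^sup>2)"
  have "wiener_bound (h + 1 / (pi\<^sup>2 * h) * (2 * Z)) (\<lambda>\<zeta>. complex_of_real (tent h \<zeta>))"
    unfolding wiener_bound_def
  proof (intro conjI allI impI cont)
    fix S :: "int set" assume S: "finite S"
    have "(\<Sum>k\<in>S. cmod (fourier_coeff (\<lambda>\<zeta>. complex_of_real (tent h \<zeta>)) k)) = (\<Sum>k\<in>S. c k)"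
      using c0 by (simp add: coeff)
    also have "\<dots> \<le> (\<Sum>k\<in>insert 0 S. c k)" using S c0 by (intro sum_mono2) auto
    also have "\<dots> = h + (\<Sum>k\<in>S - {0}. c k)"
      using S by (subst sum.insert_remove) (auto simp: c_def)
    also have "(\<Sum>k\<in>S - {0}. c k) \<le> (\<Sum>k\<in>S - {0}. 1 / (pi\<^sup>2 * h) * (1 / (of_int k)\<^sup>2))"
    proof (rule sum_mono)
      fix k assume "k \<in> S - {0}"
      then have k: "k \<noteq> 0" by simp
      have "1 - cos (2 * pi * of_int k * h) \<le> 2"
        using cos_ge_minus_one[of "2 * pi * of_int k * h"] by linarith
      then have "(1 - cos (2 * pi * of_int k * h)) / (2 * pi\<^sup>2 * (of_int k)\<^sup>2 * h) \<le> 2 / (2 * pi\<^sup>2 * (of_int k)\<^sup>2 * h)"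
        using h by (intro divide_right_mono) auto
      moreover have "2 / (2 * pi\<^sup>2 * (of_int k)\<^sup>2 * h) = 1 / (pi\<^sup>2 * h) * (1 / (of_int k)\<^sup>2)"
        using k h by (simp add: field_simps)
      ultimately show "c k \<le> 1 / (pi\<^sup>2 * h) * (1 / (of_int k)\<^sup>2)"
        using k by (simp only: c_def if_False)
    qed
    also have "\<dots> \<le> 1 / (pi\<^sup>2 * h) * (2 * Z)"
      unfolding sum_distrib_left[symmetric] Z_def
      using S h by (intro mult_left_mono sum_inverse_squares_int_le) auto
    finally show "(\<Sum>k\<in>S. cmod (fourier_coeff (\<lambda>\<zeta>. complex_of_real (tent h \<zeta>)) k)) \<le> h + 1 / (pi\<^sup>2 * h) * (2 * Z)" by simp
  qed
  note inv = fourier_inversion[OF this]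
  show ?thesis
    unfolding wiener_bound_def
  proof (intro conjI allI impI cont)
    fix S :: "int set" assume S: "finite S"
    have "sum c S \<le> 1 + e" if e: "e > 0" for e
    proof -
      from inv[OF e S] obtain T where T: "finite T" "S \<subseteq> T"
        "\<forall>\<zeta>\<in>circle. cmod (complex_of_real (tent h \<zeta>) - (\<Sum>k\<in>T. fourier_coeff (\<lambda>\<zeta>. complex_of_real (tent h \<zeta>)) k * \<zeta> powi k)) \<le> e"
        by blast
      have "cmod (complex_of_real (tent h 1) - (\<Sum>k\<in>T. fourier_coeff (\<lambda>\<zeta>. complex_of_real (tent h \<zeta>)) k * 1 powi k)) \<le> e"
        by (rule T(3)[rule_format]) simp
      moreover have "tent h 1 = 1" by (simp add: tent_def)
      ultimately have "cmod (complex_of_real (1 - sum c T)) \<le> e"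
        by (simp add: coeff)
      then have "sum c T \<le> 1 + e" unfolding norm_of_real by linarith
      moreover have "sum c S \<le> sum c T" using T c0 by (intro sum_mono2) auto
      ultimately show ?thesis by linarith
    qed
    then have "sum c S \<le> 1" by (rule field_le_epsilon)
    then show "(\<Sum>k\<in>S. cmod (fourier_coeff (\<lambda>\<zeta>. complex_of_real (tent h \<zeta>)) k)) \<le> 1"
      using c0 by (simp add: coeff)
  qed
qed

text \<open>
  The trapezoid equal to \<open>1\<close> on \<open>\<bar>t\<bar> \<le> h\<close> and supported on \<open>\<bar>t\<bar> \<le> 2 * h\<close>. As a combination of two
  tents it has a Wiener norm bounded independently of the width, while its mean is only \<open>3 * h\<close>.
\<close>
definition bump :: "real \<Rightarrow> complex \<Rightarrow> real" where
  "bump h \<zeta> = 2 * tent (2 * h) \<zeta> - tent h \<zeta>"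

lemma continuous_on_bump: "continuous_on circle (bump h)"
  unfolding bump_def by (intro continuous_intros continuous_on_tent)

lemma bump_bounds:
  assumes "0 < h" "\<zeta> \<in> circle"
  shows "0 \<le> bump h \<zeta>" "bump h \<zeta> \<le> 1"
proof -
  define x where "x = arccos (Re \<zeta>) / (2 * pi * h)"
  have "x \<ge> 0" using assms Re_circle_bounds[of \<zeta>] by (simp add: x_def arccos_lbound)
  moreover have "bump h \<zeta> = 2 * max 0 (1 - x / 2) - max 0 (1 - x)"
    by (simp add: bump_def tent_def x_def)
  ultimately show "0 \<le> bump h \<zeta>" "bump h \<zeta> \<le> 1" by (auto simp: max_def)
qed

lemma bump_eq_1:
  assumes h: "0 < h" "h \<le> 1 / 2" and "\<zeta> \<in> circle" "cos (2 * pi * h) < Re \<zeta>"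
  shows "bump h \<zeta> = 1"
proof -
  have "arccos (Re \<zeta>) < arccos (cos (2 * pi * h))"
    using assms Re_circle_bounds[of \<zeta>] cos_ge_minus_one by (intro arccos_less_arccos) auto
  also have "arccos (cos (2 * pi * h)) = 2 * pi * h" using h by (intro arccos_cos) auto
  finally have "arccos (Re \<zeta>) / (2 * pi * h) < 1" using h by (simp add: field_simps)
  moreover have "arccos (Re \<zeta>) / (2 * pi * (2 * h)) = arccos (Re \<zeta>) / (2 * pi * h) / 2" by simp
  ultimately show ?thesis unfolding bump_def tent_def by simp
qed

lemma wiener_bound_bump:
  assumes h: "0 < h" "h \<le> 1 / 4"
  shows "wiener_bound 3 (\<lambda>\<zeta>. complex_of_real (bump h \<zeta>))"
proof -
  have "wiener_bound (cmod 2 * 1 + 1) (\<lambda>\<zeta>. 2 * complex_of_real (tent (2 * h) \<zeta>) - complex_of_real (tent h \<zeta>))"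
    using h by (intro wiener_bound_diff wiener_bound_cmult wiener_bound_tent) auto
  then show ?thesis by (simp add: bump_def)
qed

lemma integral_bump_dilate:
  assumes h: "0 < h" "h \<le> 1 / 4" and N: "N \<ge> 1"
  shows "(\<integral>\<zeta>. bump h (\<zeta> ^ N) \<partial>circle_lebesgue) = 3 * h"
proof -
  have tc: "continuous_on circle (\<lambda>\<zeta>. complex_of_real (tent h \<zeta>))" for h
    by (intro continuous_intros continuous_on_tent)
  have t2: "continuous_on circle (\<lambda>\<zeta>. 2 * complex_of_real (tent (2 * h) \<zeta>))"
    by (intro continuous_on_mult continuous_on_const tc)
  have "complex_of_real (\<integral>\<zeta>. bump h (\<zeta> ^ N) \<partial>circle_lebesgue) =
      fourier_coeff (\<lambda>\<zeta>. complex_of_real (bump h (\<zeta> ^ N))) 0"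
    by (simp add: fourier_coeff_def)
  also have "\<dots> = fourier_coeff (\<lambda>\<zeta>. complex_of_real (bump h \<zeta>)) 0"
    by (rule fourier_coeff_0_dilate[OF wiener_bound_bump[OF h] N])
  also have "\<dots> = fourier_coeff (\<lambda>\<zeta>. 2 * complex_of_real (tent (2 * h) \<zeta>) - complex_of_real (tent h \<zeta>)) 0"
    by (simp add: bump_def)
  also have "\<dots> = 2 * complex_of_real (2 * h) - complex_of_real h"
    unfolding fourier_coeff_diff[OF t2 tc] fourier_coeff_cmult using h by (simp add: fourier_coeff_tent)
  also have "\<dots> = complex_of_real (3 * h)" by simp
  finally show ?thesis by (simp only: of_real_eq_iff)
qed

section \<open>The function supported on E\<close>

text \<open>
  Interpolation: \<open>cmod (d j n) powr r \<le> \<eta> j powr (r - 1) * cmod (d j n)\<close> bounds the \<open>r\<close>-norm of each term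
  by its sup norm and its \<open>1\<close>-norm. The factors \<open>2 ^ (j + 1)\<close> replace Minkowski's inequality: if
  \<open>2 ^ (j + 1) * x j \<le> y\<close> for all \<open>j\<close>, then the sum of the \<open>x j\<close> is at most \<open>y\<close>.
\<close>
lemma powr_summable_of_interpolation:
  fixes d :: "nat \<Rightarrow> int \<Rightarrow> complex" and \<eta> K :: "nat \<Rightarrow> real"
  assumes r: "r > 1"
    and l1: "\<And>j S. finite S \<Longrightarrow> (\<Sum>n\<in>S. cmod (d j n)) \<le> K j"
    and sup: "\<And>j n. cmod (d j n) \<le> \<eta> j"
    and sm: "summable (\<lambda>j. 2 powr ((real j + 1) * r) * \<eta> j powr (r - 1) * K j)"
    and a: "\<And>n. (\<lambda>j. d j n) sums a n"
  shows "(\<lambda>n. cmod (a n) powr r) summable_on UNIV"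
proof -
  define w where "w j = 2 powr ((real j + 1) * r) * \<eta> j powr (r - 1)" for j
  have w0: "w j \<ge> 0" for j by (simp add: w_def)
  have terms: "summable (\<lambda>j. w j * cmod (d j n))" for n
  proof (rule summable_comparison_test'[OF sm[folded w_def]])
    show "norm (w j * cmod (d j n)) \<le> w j * K j" for j
      using l1[of "{n}" j] w0[of j] by (simp add: mult_left_mono)
  qed
  define Y where "Y n = (\<Sum>j. w j * cmod (d j n))" for n
  have Y0: "Y n \<ge> 0" for n unfolding Y_def by (intro suminf_nonneg terms) (simp add: w0)
  have bound: "cmod (a n) powr r \<le> Y n" for n
  proof -
    define y where "y = Y n powr (1 / r)"
    have each: "cmod (d j n) \<le> y * (1 / 2) ^ Suc j" for j
    proof -
      have "cmod (d j n) powr r = cmod (d j n) * cmod (d j n) powr (r - 1)"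
        by (cases "d j n = 0") (simp_all add: powr_diff)
      also have "\<dots> \<le> cmod (d j n) * \<eta> j powr (r - 1)"
        using r sup by (intro mult_left_mono powr_mono2) auto
      finally have "2 powr ((real j + 1) * r) * cmod (d j n) powr r \<le> w j * cmod (d j n)"
        by (simp add: w_def mult_left_mono mult_ac)
      moreover have "w j * cmod (d j n) \<le> Y n"
        using sum_le_suminf[OF terms, of "{j}" n] w0 by (simp add: Y_def)
      moreover have "2 powr ((real j + 1) * r) * cmod (d j n) powr r = (2 ^ Suc j * cmod (d j n)) powr r"
        by (simp add: powr_mult powr_powr[symmetric] powr_add powr_realpow)
      ultimately have "(2 ^ Suc j * cmod (d j n)) powr r \<le> Y n" by linarith
      then have "((2 ^ Suc j * cmod (d j n)) powr r) powr (1 / r) \<le> y"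
        unfolding y_def using r by (intro powr_mono2) auto
      then have "2 ^ Suc j * cmod (d j n) \<le> y" using r by (simp add: powr_powr)
      then show ?thesis by (simp add: field_simps)
    qed
    have "(\<lambda>j. y * (1 / 2) ^ Suc j) sums (y * 1)" by (intro sums_mult power_half_series)
    then have "cmod (a n) \<le> y" using norm_sums_le[OF a _ each] by simp
    then have "cmod (a n) powr r \<le> y powr r" using r by (intro powr_mono2) auto
    also have "\<dots> = Y n" using r Y0 by (simp add: y_def powr_powr)
    finally show ?thesis .
  qed
  show ?thesis
  proof (rule nonneg_bdd_above_summable_on)
    show "bdd_above (sum (\<lambda>n. cmod (a n) powr r) ` {F. F \<subseteq> UNIV \<and> finite F})"
    proof (rule bdd_aboveI2)
      fix S :: "int set" assume "S \<in> {F. F \<subseteq> UNIV \<and> finite F}"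
      then have S: "finite S" by simp
      have "(\<Sum>n\<in>S. cmod (a n) powr r) \<le> (\<Sum>n\<in>S. Y n)" by (intro sum_mono bound)
      also have "\<dots> = (\<Sum>j. \<Sum>n\<in>S. w j * cmod (d j n))"
        unfolding Y_def by (rule suminf_sum[symmetric]) (rule terms)
      also have "\<dots> \<le> (\<Sum>j. w j * K j)"
      proof (rule suminf_le)
        show "(\<Sum>n\<in>S. w j * cmod (d j n)) \<le> w j * K j" for j
          unfolding sum_distrib_left[symmetric] by (intro mult_left_mono l1 S w0)
        show "summable (\<lambda>j. \<Sum>n\<in>S. w j * cmod (d j n))" by (intro summable_sum terms)
        show "summable (\<lambda>j. w j * K j)" using sm by (simp add: w_def)
      qed
      finally show "(\<Sum>n\<in>S. cmod (a n) powr r) \<le> (\<Sum>j. w j * K j)" .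
    qed
  qed simp
qed

text \<open>
  For every \<open>r > 1\<close> the factor \<open>2 powr (- (r - 1) * j\<^sup>2)\<close> beats all the exponential growth. A merely
  exponential decay of the widths of the bumps would not do for \<open>r\<close> close to \<open>1\<close>.
\<close>
lemma summable_gaussian_weights:
  fixes r :: real
  assumes r: "r > 1"
  shows "summable (\<lambda>j::nat. 2 powr ((real j + 1) * r) * ((1 / 2) ^ (j\<^sup>2)) powr (r - 1) * (4 ^ j * 3))"
proof (rule summable_comparison_test_ev[OF _ summable_geometric[of "1 / 2 :: real"]])
  have "eventually (\<lambda>j::nat. (real j + 1) * r - (real j)\<^sup>2 * (r - 1) + 2 * real j + 2 \<le> - real j) at_top"
    using r by real_asymp
  then show "eventually (\<lambda>j. norm (2 powr ((real j + 1) * r) * ((1 / 2) ^ (j\<^sup>2)) powr (r - 1) * (4 ^ j * 3)) \<le> (1 / 2 :: real) ^ j) at_top"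
  proof eventually_elim
    case (elim j)
    have "(1 / 2 :: real) ^ (j\<^sup>2) = 2 powr (- (real j)\<^sup>2)"
      using powr_realpow[of 2 "j\<^sup>2"] by (simp add: powr_minus power_one_over inverse_eq_divide)
    then have "((1 / 2 :: real) ^ (j\<^sup>2)) powr (r - 1) = 2 powr (- (real j)\<^sup>2 * (r - 1))"
      by (simp add: powr_powr)
    moreover have "(4::real) ^ j = 2 powr (2 * real j)"
      using powr_realpow[of 2 "2 * j"] by (simp add: power_mult)
    ultimately have "norm (2 powr ((real j + 1) * r) * ((1 / 2) ^ (j\<^sup>2)) powr (r - 1) * (4 ^ j * 3)) \<le>
        2 powr ((real j + 1) * r) * 2 powr (- (real j)\<^sup>2 * (r - 1)) * (2 powr (2 * real j) * 2 powr 2)"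
      by simp
    also have "\<dots> = 2 powr ((real j + 1) * r + (- (real j)\<^sup>2 * (r - 1)) + (2 * real j + 2))"
      by (simp only: powr_add)
    also have "\<dots> \<le> 2 powr (- real j)" using elim by (intro powr_mono) auto
    also have "\<dots> = (1 / 2) ^ j" by (simp add: powr_minus powr_realpow power_one_over inverse_eq_divide)
    finally show ?case .
  qed
qed simp

text \<open>
  \<open>f\<close> is the infinite product of the functions \<open>1 - bump (h j) (\<zeta> ^ N j)\<close>. Each new factor changes the
  partial product by at most the bump, whose mean is \<open>3 * h j\<close>; this bounds both the loss of mass
  and the sup norm of the change \<open>d j\<close> of the Fourier coefficients, while the \<open>1\<close>-norm of \<open>d j\<close> is at
  most \<open>4 ^ j * 3\<close> in the Wiener algebra.
\<close>
lemma bump_product: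
  fixes \<epsilon> :: real and N :: "nat \<Rightarrow> nat"
  assumes \<epsilon>: "0 < \<epsilon>" "\<epsilon> < 1" and N: "\<And>j. N j \<ge> 1"
  defines "h \<equiv> \<lambda>j::nat. \<epsilon> / 8 * (1 / 2) ^ (j\<^sup>2)"
  shows "\<exists>f. f \<in> borel_measurable circle_lebesgue \<and>
    (\<forall>\<zeta>\<in>circle. 0 \<le> f \<zeta> \<and> f \<zeta> \<le> (1::real)) \<and>
    (\<forall>\<zeta>\<in>circle. \<forall>j. cos (2 * pi * h j) < Re (\<zeta> ^ N j) \<longrightarrow> f \<zeta> = 0) \<and>
    1 - \<epsilon> < (\<integral>\<zeta>. f \<zeta> \<partial>circle_lebesgue) \<and>
    (\<forall>r>1. fourier_coeff (\<lambda>\<zeta>. complex_of_real (f \<zeta>)) \<in> ell r)"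
proof -
  have half: "(1 / 2 :: real) ^ (j\<^sup>2) \<le> (1 / 2) ^ j" for j :: nat
    by (rule power_decreasing) (auto simp: power2_eq_square)
  have h0: "0 < h j" for j using \<epsilon> by (simp add: h_def)
  have h_le: "h j \<le> \<epsilon> / 8 * (1 / 2) ^ j" for j
    unfolding h_def using \<epsilon> half[of j] by (intro mult_left_mono) auto
  have h4: "h j \<le> 1 / 4" for j
  proof -
    have "\<epsilon> / 8 * (1 / 2) ^ j \<le> 1 / 4 * 1" using \<epsilon> by (intro mult_mono) (auto simp: power_le_one)
    then show ?thesis using h_le[of j] by simp
  qed
  define b where "b j \<zeta> = bump (h j) (\<zeta> ^ N j)" for j \<zeta>
  define F where "F j \<zeta> = (\<Prod>i<j. 1 - b i \<zeta>)" for j \<zeta>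
  have b: "0 \<le> b j \<zeta>" "b j \<zeta> \<le> 1" if "\<zeta> \<in> circle" for j \<zeta>
    unfolding b_def using bump_bounds[OF h0 power_in_circle[OF that]] by auto
  have F01: "0 \<le> F j \<zeta>" "F j \<zeta> \<le> 1" if "\<zeta> \<in> circle" for j \<zeta>
    unfolding F_def using b[OF that] by (auto intro!: prod_nonneg prod_le_1)
  have F_Suc: "F (Suc j) \<zeta> = F j \<zeta> * (1 - b j \<zeta>)" for j \<zeta> by (simp add: F_def)
  have F_dec: "F (Suc j) \<zeta> \<le> F j \<zeta>" if "\<zeta> \<in> circle" for j \<zeta>
    using mult_left_mono[of "1 - b j \<zeta>" 1 "F j \<zeta>"] b[OF that] F01[OF that] by (simp add: F_Suc)
  define f where "f \<zeta> = lim (\<lambda>j. F j \<zeta>)" for \<zeta>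
  have F_lim: "(\<lambda>j. F j \<zeta>) \<longlonglongrightarrow> f \<zeta>" if z: "\<zeta> \<in> circle" for \<zeta>
  proof -
    have "decseq (\<lambda>j. F j \<zeta>)" by (rule decseq_SucI) (rule F_dec[OF z])
    then have "convergent (\<lambda>j. F j \<zeta>)"
      using decseq_convergent[of "\<lambda>j. F j \<zeta>" 0] F01[OF z] unfolding convergent_def by metis
    then show ?thesis unfolding f_def by (simp add: convergent_LIMSEQ_iff)
  qed
  have b_cont: "continuous_on circle (b j)" for j
    unfolding b_def by (rule continuous_on_dilate[OF continuous_on_bump])
  have F_cont: "continuous_on circle (F j)" for j
    unfolding F_def by (intro continuous_intros b_cont)
  have F_meas: "F j \<in> borel_measurable circle_lebesgue" for j
    using integrable_circle_continuous[OF F_cont] by (rule borel_measurable_integrable)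
  have f_meas: "f \<in> borel_measurable circle_lebesgue"
    by (rule borel_measurable_LIMSEQ_real[where u = F]) (simp_all add: F_lim F_meas)
  have f01: "0 \<le> f \<zeta>" "f \<zeta> \<le> 1" if "\<zeta> \<in> circle" for \<zeta>
    using LIMSEQ_le_const[OF F_lim[OF that]] LIMSEQ_le_const2[OF F_lim[OF that]] F01[OF that]
    by blast+

  have f_zero: "f \<zeta> = 0" if z: "\<zeta> \<in> circle" and gt: "cos (2 * pi * h j) < Re (\<zeta> ^ N j)" for \<zeta> j
  proof -
    have "b j \<zeta> = 1"
      unfolding b_def using h4[of j] by (intro bump_eq_1 h0 power_in_circle z gt) auto
    then have "F i \<zeta> = 0" if "i > j" for i
      using that unfolding F_def by (intro prod_zero) auto
    then have "eventually (\<lambda>i. F i \<zeta> = 0) sequentially"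
      by (rule eventually_mono[OF eventually_gt_at_top])
    from LIMSEQ_unique[OF F_lim[OF z] tendsto_eventually[OF this]] show ?thesis .
  qed

  have int_b: "(\<integral>\<zeta>. b j \<zeta> \<partial>circle_lebesgue) = 3 * h j" for j
    unfolding b_def by (rule integral_bump_dilate[OF h0 h4 N])
  have int_Fb: "(\<integral>\<zeta>. F j \<zeta> * b j \<zeta> \<partial>circle_lebesgue) \<le> 3 * h j" for j
  proof -
    have "(\<integral>\<zeta>. F j \<zeta> * b j \<zeta> \<partial>circle_lebesgue) \<le> (\<integral>\<zeta>. b j \<zeta> \<partial>circle_lebesgue)"
    proof (intro integral_mono integrable_circle_continuous continuous_intros F_cont b_cont)
      fix \<zeta> assume "\<zeta> \<in> space circle_lebesgue"
      then show "F j \<zeta> * b j \<zeta> \<le> b j \<zeta>"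
        using F01[of \<zeta> j] b[of \<zeta> j] by (simp add: mult_left_le_one_le)
    qed
    then show ?thesis by (simp add: int_b)
  qed
  have F_diff: "F j \<zeta> - F (Suc j) \<zeta> = F j \<zeta> * b j \<zeta>" for j \<zeta>
    by (simp add: F_Suc algebra_simps)
  have int_F: "1 - 3 * (\<Sum>i<j. h i) \<le> (\<integral>\<zeta>. F j \<zeta> \<partial>circle_lebesgue)" for j
  proof (induction j)
    case 0
    show ?case by (simp add: F_def measure_circle_lebesgue_circle)
  next
    case (Suc j)
    have "(\<integral>\<zeta>. F j \<zeta> \<partial>circle_lebesgue) - (\<integral>\<zeta>. F (Suc j) \<zeta> \<partial>circle_lebesgue) \<le> 3 * h j"
      using int_Fb[of j] Bochner_Integration.integral_diff[OF integrable_circle_continuous[OF F_cont[of j]]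
        integrable_circle_continuous[OF F_cont[of "Suc j"]]] by (simp add: F_diff)
    with Suc show ?case by simp
  qed
  have sum_h: "(\<Sum>i<j. h i) \<le> \<epsilon> / 4" for j
  proof -
    have "(\<Sum>i<j. h i) \<le> (\<Sum>i<j. \<epsilon> / 8 * (1 / 2) ^ i)" by (intro sum_mono h_le)
    also have "\<dots> = \<epsilon> / 8 * (\<Sum>i<j. (1 / 2) ^ i)" by (simp only: sum_distrib_left)
    also have "\<dots> \<le> \<epsilon> / 8 * 2"
    proof (intro mult_left_mono)
      have "(\<Sum>i<j. (1 / 2 :: real) ^ i) \<le> (\<Sum>i. (1 / 2) ^ i)"
        by (intro sum_le_suminf summable_geometric) auto
      then show "(\<Sum>i<j. (1 / 2 :: real) ^ i) \<le> 2" by (simp add: suminf_geometric)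
    qed (use \<epsilon> in simp)
    finally show ?thesis by simp
  qed
  have int_F': "1 - 3 * \<epsilon> / 4 \<le> (\<integral>\<zeta>. F j \<zeta> \<partial>circle_lebesgue)" for j
    using int_F[of j] sum_h[of j] by linarith
  have one: "integrable circle_lebesgue (\<lambda>_. 1 :: real)"
    by (rule integrable_circle_continuous) simp
  have "(\<lambda>j. \<integral>\<zeta>. F j \<zeta> \<partial>circle_lebesgue) \<longlonglongrightarrow> (\<integral>\<zeta>. f \<zeta> \<partial>circle_lebesgue)"
    by (rule integral_dominated_convergence[OF f_meas F_meas one])
      (auto intro!: AE_I2 F_lim simp: abs_le_iff F01 order_trans[OF _ F01(1)])
  then have "1 - 3 * \<epsilon> / 4 \<le> (\<integral>\<zeta>. f \<zeta> \<partial>circle_lebesgue)"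
    by (rule LIMSEQ_le_const) (use int_F' in blast)
  then have int_f: "1 - \<epsilon> < (\<integral>\<zeta>. f \<zeta> \<partial>circle_lebesgue)" using \<epsilon> by simp

  have wb: "wiener_bound (4 ^ j) (\<lambda>\<zeta>. complex_of_real (F j \<zeta>))" for j
  proof (induction j)
    case 0
    show ?case using wiener_bound_1 by (simp add: F_def)
  next
    case (Suc j)
    have "wiener_bound (1 + 3) (\<lambda>\<zeta>. 1 - complex_of_real (bump (h j) \<zeta>))"
      by (intro wiener_bound_diff wiener_bound_1 wiener_bound_bump h0 h4)
    from wiener_bound_mult_dilate[OF Suc.IH this, of "N j"] show ?case
      by (simp add: F_Suc b_def mult.commute)
  qed
  define d where "d j n = fourier_coeff (\<lambda>\<zeta>. complex_of_real (F j \<zeta>) * complex_of_real (b j \<zeta>)) n" for j n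
  have d_l1: "(\<Sum>n\<in>S. cmod (d j n)) \<le> 4 ^ j * 3" if "finite S" for j S
    using wiener_boundD(2)[OF wiener_bound_mult_dilate[OF wb wiener_bound_bump[OF h0 h4]] that]
    unfolding d_def b_def .
  have d_sup: "cmod (d j n) \<le> (1 / 2) ^ (j\<^sup>2)" for j n
  proof -
    have "cmod (d j n) \<le> (\<integral>\<zeta>. cmod (complex_of_real (F j \<zeta>) * complex_of_real (b j \<zeta>) * \<zeta> powi (- n)) \<partial>circle_lebesgue)"
      unfolding d_def fourier_coeff_def by (rule integral_norm_bound)
    also have "\<dots> = (\<integral>\<zeta>. F j \<zeta> * b j \<zeta> \<partial>circle_lebesgue)"
      using F01 b by (intro Bochner_Integration.integral_cong refl) (simp add: norm_mult norm_power_int)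
    also have "\<dots> \<le> 3 * h j" by (rule int_Fb)
    also have "\<dots> \<le> (1 / 2) ^ (j\<^sup>2)" using \<epsilon> by (simp add: h_def)
    finally show ?thesis .
  qed
  have Fc_cont: "continuous_on circle (\<lambda>\<zeta>. complex_of_real (F j \<zeta>))" for j
    by (intro continuous_intros F_cont)
  have d_eq: "d j n = fourier_coeff (\<lambda>\<zeta>. complex_of_real (F j \<zeta>)) n - fourier_coeff (\<lambda>\<zeta>. complex_of_real (F (Suc j) \<zeta>)) n" for j n
    unfolding d_def fourier_coeff_diff[OF Fc_cont Fc_cont, symmetric] by (simp flip: of_real_diff of_real_mult F_diff)
  have coeff_lim: "(\<lambda>j. fourier_coeff (\<lambda>\<zeta>. complex_of_real (F j \<zeta>)) n) \<longlonglongrightarrow> fourier_coeff (\<lambda>\<zeta>. complex_of_real (f \<zeta>)) n" for n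
    unfolding fourier_coeff_def
  proof (rule integral_dominated_convergence[OF _ _ one])
    have p: "(\<lambda>\<zeta>. \<zeta> powi (- n)) \<in> borel_measurable circle_lebesgue"
      by (rule borel_measurable_integrable[OF integrable_circle_continuous])
        (intro continuous_intros, auto simp: circle_nonzero)
    note f_meas[measurable] F_meas[measurable] p[measurable]
    show "(\<lambda>\<zeta>. complex_of_real (f \<zeta>) * \<zeta> powi (- n)) \<in> borel_measurable circle_lebesgue" by measurable
    show "(\<lambda>\<zeta>. complex_of_real (F j \<zeta>) * \<zeta> powi (- n)) \<in> borel_measurable circle_lebesgue" for j by measurable
    show "AE \<zeta> in circle_lebesgue. (\<lambda>j. complex_of_real (F j \<zeta>) * \<zeta> powi (- n)) \<longlonglongrightarrow> complex_of_real (f \<zeta>) * \<zeta> powi (- n)"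
      by (intro AE_I2 tendsto_mult tendsto_of_real F_lim tendsto_const) simp
    show "AE \<zeta> in circle_lebesgue. norm (complex_of_real (F j \<zeta>) * \<zeta> powi (- n)) \<le> 1" for j
      using F01 by (intro AE_I2) (simp add: norm_mult norm_power_int)
  qed
  define a where "a n = fourier_coeff (\<lambda>\<zeta>. complex_of_real (F 0 \<zeta>)) n - fourier_coeff (\<lambda>\<zeta>. complex_of_real (f \<zeta>)) n" for n
  have d_sums: "(\<lambda>j. d j n) sums a n" for n
    unfolding d_eq a_def by (rule telescope_sums'[OF coeff_lim])
  have ell: "fourier_coeff (\<lambda>\<zeta>. complex_of_real (f \<zeta>)) \<in> ell r" if r: "1 < r" for r
  proof -
    have a: "(\<lambda>n. cmod (a n) powr r) summable_on UNIV"
      by (rule powr_summable_of_interpolation[OF r d_l1 d_sup summable_gaussian_weights[OF r] d_sums])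
    \<comment> \<open>The empty product is \<open>1\<close>, whose only nonzero coefficient is the one at \<open>0\<close>.\<close>
    have "cmod (fourier_coeff (\<lambda>\<zeta>. complex_of_real (f \<zeta>)) n) powr r = cmod (a n) powr r" if "n \<noteq> 0" for n
      using fourier_coeff_powi[of 0 n] that by (simp add: a_def F_def)
    then have "(\<lambda>n. cmod (fourier_coeff (\<lambda>\<zeta>. complex_of_real (f \<zeta>)) n) powr r) summable_on UNIV - {0}
        \<longleftrightarrow> (\<lambda>n. cmod (a n) powr r) summable_on UNIV - {0}"
      by (intro summable_on_cong) auto
    moreover have "(\<lambda>n. cmod (a n) powr r) summable_on UNIV - {0}"
      using summable_on_insert_iff[of "\<lambda>n. cmod (a n) powr r" 0 "UNIV - {0}"] a by (simp add: insert_Diff_single)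
    ultimately show ?thesis
      using summable_on_insert_iff[of "\<lambda>n. cmod (fourier_coeff (\<lambda>\<zeta>. complex_of_real (f \<zeta>)) n) powr r" 0 "UNIV - {0}"]
      by (simp add: ell_def insert_Diff_single)
  qed
  show ?thesis
    by (intro exI[of _ f] conjI ballI allI impI f_meas f01 f_zero int_f ell)
qed

theorem theorem1p2:
  fixes \<Omega> :: "nat \<Rightarrow> real"
  assumes "\<And>n. n \<ge> 1 \<Longrightarrow> \<Omega> n > 0"
    and "antimono_on {1..} \<Omega>"
    and "\<Omega> \<longlonglongrightarrow> 0"
  shows "\<forall>\<epsilon>::real. 0 < \<epsilon> \<and> \<epsilon> < 1 \<longrightarrow>
    (\<exists>E. E \<subseteq> circle \<and> compact E \<and> measure circle_lebesgue E > 1 - \<epsilon> \<and>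
      (\<exists>f :: complex \<Rightarrow> real.
          f \<in> borel_measurable circle_lebesgue \<and>
          integrable circle_lebesgue (\<lambda>\<zeta>. (f \<zeta>)\<^sup>2) \<and>
          (\<forall>\<zeta>\<in>circle. f \<zeta> \<ge> 0) \<and>
          \<not> (AE \<zeta> in circle_lebesgue. f \<zeta> = 0) \<and>
          (AE \<zeta> in circle_lebesgue. \<zeta> \<notin> E \<longrightarrow> f \<zeta> = 0) \<and>
          fourier_coeff (\<lambda>\<zeta>. complex_of_real (f \<zeta>)) \<in> (\<Inter>r\<in>{1<..}. ell r)) \<and>
      (\<forall>\<mu>\<in>measures_on E.
          (\<forall>n\<ge>1. cmod (fourier_coeff_measure \<mu> (int n)) \<le> \<Omega> n) \<longrightarrow>
          (\<forall>A\<in>sets circle_borel. \<mu> A = 0)))"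
proof (intro allI impI, elim conjE)
  fix \<epsilon> :: real assume \<epsilon>: "0 < \<epsilon>" "\<epsilon> < 1"
  define h where "h j = \<epsilon> / 8 * (1 / 2) ^ (j\<^sup>2)" for j :: nat
  define \<kappa> where "\<kappa> j = cos (2 * pi * h j)" for j
  have \<kappa>: "\<kappa> j < 1" for j
  proof -
    have "h j > 0" using \<epsilon> by (simp add: h_def)
    moreover have "h j \<le> 1 / 8 * 1"
      unfolding h_def using \<epsilon> by (intro mult_mono power_le_one) auto
    ultimately have "cos (2 * pi * h j) < cos 0" by (intro cos_monotone_0_pi) auto
    then show ?thesis by (simp add: \<kappa>_def)
  qed
  have "\<exists>q. poly q 0 = 1 \<and> (\<forall>z\<in>circle. Re z \<le> \<kappa> j \<longrightarrow> cmod (poly q z) \<le> 1 / 2 ^ j)" for j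
    by (rule poly_small_off_arc[OF \<kappa>]) simp
  then obtain q where q: "\<And>j. poly (q j) 0 = 1"
    "\<And>j z. z \<in> circle \<Longrightarrow> Re z \<le> \<kappa> j \<Longrightarrow> cmod (poly (q j) z) \<le> 1 / 2 ^ j" by metis
  define S where "S j = (\<Sum>i=1..degree (q j). cmod (coeff (q j) i))" for j
  \<comment> \<open>The dilation comes last: it may depend on the coefficients of \<open>q j\<close>, as \<open>\<Omega>\<close> tends to \<open>0\<close>.\<close>
  have "\<exists>N. j < N \<and> (\<forall>n. N - j \<le> n \<longrightarrow> S j * \<Omega> n \<le> 1 / 2 ^ j)" for j
  proof -
    have "(\<lambda>n. S j * \<Omega> n) \<longlonglongrightarrow> S j * 0" by (intro tendsto_intros assms(3))
    then have "eventually (\<lambda>n. S j * \<Omega> n < 1 / 2 ^ j) sequentially" by (rule order_tendstoD) simp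
    then obtain M where "\<And>n. n \<ge> M \<Longrightarrow> S j * \<Omega> n < 1 / 2 ^ j" by (auto simp: eventually_sequentially)
    then show ?thesis by (intro exI[of _ "M + j + 1"]) (auto intro!: less_imp_le)
  qed
  then obtain N where N: "\<And>j. j < N j" "\<And>j n. N j - j \<le> n \<Longrightarrow> S j * \<Omega> n \<le> 1 / 2 ^ j" by metis
  have N1: "N j \<ge> 1" for j using N(1)[of j] by simp
  define E where "E = circle \<inter> (\<Inter>j. {\<zeta>. Re (\<zeta> ^ N j) \<le> \<kappa> j})"
  have "closed {\<zeta>::complex. Re (\<zeta> ^ N j) \<le> \<kappa> j}" for j
    by (intro closed_Collect_le continuous_intros)
  then have E: "compact E" unfolding E_def by (intro compact_Int_closed compact_circle closed_INT) auto
  have E_closed: "closed E" and E_circle: "E \<subseteq> circle"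
    using E by (auto simp: compact_imp_closed E_def)
  from bump_product[where N = N, OF \<epsilon> N1, folded h_def, folded \<kappa>_def]
  obtain f :: "complex \<Rightarrow> real" where f: "f \<in> borel_measurable circle_lebesgue"
    "\<forall>\<zeta>\<in>circle. 0 \<le> f \<zeta> \<and> f \<zeta> \<le> 1"
    "\<forall>\<zeta>\<in>circle. \<forall>j. \<kappa> j < Re (\<zeta> ^ N j) \<longrightarrow> f \<zeta> = 0"
    "1 - \<epsilon> < (\<integral>\<zeta>. f \<zeta> \<partial>circle_lebesgue)"
    "\<forall>r>1. fourier_coeff (\<lambda>\<zeta>. complex_of_real (f \<zeta>)) \<in> ell r"
    by blast
  interpret finite_measure circle_lebesgue by (rule finite_measure_circle_lebesgue)
  have off: "f \<zeta> = 0" if "\<zeta> \<in> circle" "\<zeta> \<notin> E" for \<zeta>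
    using that f(3) by (auto simp: E_def not_le)
  have E_sets: "E \<in> sets circle_lebesgue"
    using E_closed E_circle by (auto simp: sets_circle_borel_iff)
  have int: "integrable circle_lebesgue f"
    by (rule integrable_const_bound[of _ 1]) (use f in \<open>auto intro!: AE_I2\<close>)
  have "(\<integral>\<zeta>. f \<zeta> \<partial>circle_lebesgue) \<le> (\<integral>\<zeta>. indicator E \<zeta> \<partial>circle_lebesgue)"
  proof (rule integral_mono[OF int])
    show "integrable circle_lebesgue (indicator E :: complex \<Rightarrow> real)"
      using E_sets by (simp add: emeasure_eq_measure)
    fix \<zeta> assume "\<zeta> \<in> space circle_lebesgue"
    then show "f \<zeta> \<le> indicator E \<zeta>" using f(2) off by (auto simp: indicator_def)
  qed
  \<comment> \<open>As \<open>f\<close> lies below the indicator of \<open>E\<close>, the bound on its integral also bounds \<open>m(E)\<close>.\<close>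
  then have mE: "1 - \<epsilon> < measure circle_lebesgue E"
    using f(4) E_circle by (simp add: Int_absorb2)
  have sq: "integrable circle_lebesgue (\<lambda>\<zeta>. (f \<zeta>)\<^sup>2)"
  proof (rule integrable_const_bound[of _ 1])
    show "AE \<zeta> in circle_lebesgue. norm ((f \<zeta>)\<^sup>2) \<le> 1"
      using f(2) by (intro AE_I2) (simp add: power_le_one)
  qed (use f(1) in measurable)
  have nontrivial: "\<not> (AE \<zeta> in circle_lebesgue. f \<zeta> = 0)"
  proof
    assume "AE \<zeta> in circle_lebesgue. f \<zeta> = 0"
    then have "(\<integral>\<zeta>. f \<zeta> \<partial>circle_lebesgue) = 0" by (rule integral_eq_zero_AE)
    then show False using f(4) \<epsilon> by simp
  qed
  have unique: "\<mu> A = 0" if \<mu>: "\<mu> \<in> measures_on E"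
    and bound: "\<forall>n\<ge>1. cmod (fourier_coeff_measure \<mu> (int n)) \<le> \<Omega> n" and A: "A \<in> sets circle_borel" for \<mu> A
  proof (rule measures_on_eq_0_of_unilateral_bound[OF E_closed E_circle q _ N(1) N(2)[unfolded S_def] \<mu> _ A])
    show "Re (\<zeta> ^ N j) \<le> \<kappa> j" if "\<zeta> \<in> E" for \<zeta> j using that by (simp add: E_def)
  qed (use bound in auto)
  have "AE \<zeta> in circle_lebesgue. \<zeta> \<notin> E \<longrightarrow> f \<zeta> = 0" using off by (intro AE_I2) auto
  then show "\<exists>E. E \<subseteq> circle \<and> compact E \<and> measure circle_lebesgue E > 1 - \<epsilon> \<and>
      (\<exists>f :: complex \<Rightarrow> real.
          f \<in> borel_measurable circle_lebesgue \<and>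
          integrable circle_lebesgue (\<lambda>\<zeta>. (f \<zeta>)\<^sup>2) \<and>
          (\<forall>\<zeta>\<in>circle. f \<zeta> \<ge> 0) \<and>
          \<not> (AE \<zeta> in circle_lebesgue. f \<zeta> = 0) \<and>
          (AE \<zeta> in circle_lebesgue. \<zeta> \<notin> E \<longrightarrow> f \<zeta> = 0) \<and>
          fourier_coeff (\<lambda>\<zeta>. complex_of_real (f \<zeta>)) \<in> (\<Inter>r\<in>{1<..}. ell r)) \<and>
      (\<forall>\<mu>\<in>measures_on E.
          (\<forall>n\<ge>1. cmod (fourier_coeff_measure \<mu> (int n)) \<le> \<Omega> n) \<longrightarrow>
          (\<forall>A\<in>sets circle_borel. \<mu> A = 0))"
    using E E_circle mE f(1,2,5) sq nontrivial unique by (intro exI[of _ E] conjI exI[of _ f]) auto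
qed

end
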